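(* Let $R$ be a commutative complete semiring such that all positive sums of the multiplicative unit are invertible (i.e. for every integer $n\geq1$ the element $n=1+\dots+1$ ($n$ times) of $R$ is multiplicatively invertible). Then $R^\Pi$, with the structure described in the context, is a differential linear category with antiderivatives.
   Context: Conventions. Composition is in diagrammatic order ($fg$ means first $f$, then $g$) and the associativity and unit isomorphisms of symmetric monoidal categories $(\mathbb X,\otimes,I,\sigma)$ are suppressed. Additive symmetric monoidal category: a symmetric monoidal category whose hom-sets are commutative monoids $(+,0)$, with composition and tensor product preserving sums and zeros in each argument. Coalgebra modality $(!,\rho,\varepsilon,\Delta,\mathsf e)$: a functor $!$ with natural transformations $\rho_A:{!A}\to{!!A}$, $\varepsilon_A:{!A}\to A$, $\Delta_A:{!A}\to{!A}\otimes{!A}$, $\mathsf e_A:{!A}\to I$ such that $(!,\rho,\varepsilon)$ is a comonad, each $({!A},\Delta_A,\mathsf e_A)$ is a cocommutative comonoid, and $\rho_A$ is a comonoid morphism. Monoidal coalgebra modality: a coalgebra modality with a natural transformation $\mathsf m_{A,B}:{!A}\otimes{!B}\to{!(A\otimes B)}$ and a map $\mathsf m_I:I\to{!I}$ such that $(!,\mathsf m,\mathsf m_I)$ is a symmetric monoidal functor; $\rho,\varepsilon,\Delta,\mathsf e$ are monoidal transformations; and $\Delta,\mathsf e$ are $!$-coalgebra morphisms: $\rho_A{!(\Delta_A)}=\Delta_A(\rho_A\otimes\rho_A)\mathsf m_{!A,!A}$, $\rho_A{!(\mathsf e_A)}=\mathsf e_A\mathsf m_I$. Differential category: an additive symmetric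 monoidal category with a coalgebra modality and a deriving transformation, i.e. a natural transformation $\mathsf d_A:{!A}\otimes A\to{!A}$ with: $\mathsf d_A\mathsf e_A=0$; $\mathsf d_A\Delta_A=(\Delta_A\otimes1_A)(1_{!A}\otimes\sigma_{!A,A})(\mathsf d_A\otimes1_{!A})+(\Delta_A\otimes1_A)(1_{!A}\otimes\mathsf d_A)$; $\mathsf d_A\varepsilon_A=\mathsf e_A\otimes1_A$; $\mathsf d_A\rho_A=(\Delta_A\otimes1_A)(\rho_A\otimes\mathsf d_A)\mathsf d_{!A}$; $(\mathsf d_A\otimes1_A)\mathsf d_A=(1_{!A}\otimes\sigma_{A,A})(\mathsf d_A\otimes1_A)\mathsf d_A$. Differential linear category: a differential category whose coalgebra modality is monoidal. With $\mathsf d^\circ_A:=\Delta_A(1_{!A}\otimes\varepsilon_A):{!A}\to{!A}\otimes A$ and $\mathsf K_A:=\mathsf d^\circ_A\mathsf d_A+{!(0)}:{!A}\to{!A}$ (where $0:A\to A$ is the zero map), a differential category has antiderivatives if $\mathsf K$ is a natural isomorphism. Complete semiring: a semiring with sums $\sum_{i\in I}r_i$ indexed by arbitrary sets $I$, extending finite sums, invariant under partitioning of the index set, and such that multiplication distributes over all such sums on both sides. The category $R^\Pi$: objects are sets; a map from $X$ to $Y$ is a function $f:X\times Y\to R$; composition is $(fg)(x,z)=\sum_{y\in Y}f(x,y)\cdot g(y,z)$; the identity is the Kronecker function $\delta$ ($\delta(x,y)=1$ if $x=y$, $0$ otherwise). Sums and zeros of maps are pointwise. The tensor product is the Cartesian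 product $X\times Y$ on objects and $(f\otimes g)((x,x'),(y,y'))=f(x,y)g(x',y')$ on maps; the unit is a singleton $I=\{\ast\}$; the symmetry is the evident one. The monoidal coalgebra modality on $R^\Pi$ is the standard free exponential modality: $!X$ is the set of finite multisets (bags) of elements of $X$, i.e. the free commutative monoid on $X$, written additively, with empty bag $[\,]$. For a map $f$ from $X$ to $Y$, $$!f(p,[y_1,\dots,y_n])=\sum_{(x_1,\dots,x_n)\in X^n,\ [x_1,\dots,x_n]=p}\ \prod_{i=1}^n f(x_i,y_i).$$ Further $\varepsilon_X(p,x)=\delta(p,[x])$; $\rho_X(p,[p_1,\dots,p_k])=\delta(p,p_1+\dots+p_k)$; $\Delta_X(p,(q,r))=\delta(p,q+r)$; $\mathsf e_X(p,\ast)=\delta(p,[\,])$; $\mathsf m_{X,Y}((p,q),[(x_1,y_1),\dots,(x_n,y_n)])=\delta(p,[x_1,\dots,x_n])\,\delta(q,[y_1,\dots,y_n])$; $\mathsf m_I(\ast,p)=1$ for all $p\in{!I}$. The deriving transformation $\mathsf d_X:({!X}\times X)\times{!X}\to R$ puts a single element into a bag: $$\mathsf d_X\big(([x_1,\dots,x_n],x),[y_1,\dots,y_m]\big)=m\cdot\delta\big([x_1,\dots,x_n,x],[y_1,\dots,y_m]\big),$$ where $m$ is the total number of elements (counted with multiplicity) of the bag $[y_1,\dots,y_m]$, regarded as an element of $R$ (a sum of $m$ copies of $1$); when the value is nonzero, $m=n+1$.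
   Formalization: In the deriving transformation the coefficient m (total size of the bag) is replaced by the multiplicity of the inserted element x in the bag; with m the Leibniz rule would force 1+1=1, and when 1+1=1 the two formulas agree. *)

theory Defs
  imports "HOL-Library.Multiset" "HOL-Library.Disjoint_Sets"
begin

section \<open>Categories\<close>

text \<open>
  Composition is written in diagrammatic order. The associativity and unit isomorphisms of a
  monoidal category are explicit parameters, so that axioms usually stated with these
  isomorphisms suppressed have them inserted below.
\<close>

locale category =
  fixes Ob :: "'o set"
    and hom :: "'o \<Rightarrow> 'o \<Rightarrow> 'm set"
    and ident :: "'o \<Rightarrow> 'm"
    and comp :: "'m \<Rightarrow> 'm \<Rightarrow> 'm"  (infixl "\<cdot>" 70)
  assumes hom_Ob: "f \<in> hom A B \<Longrightarrow> A \<in> Ob \<and> B \<in> Ob"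
    and hom_unique: "f \<in> hom A B \<Longrightarrow> f \<in> hom A' B' \<Longrightarrow> A = A' \<and> B = B'"
    and ident_in_hom: "A \<in> Ob \<Longrightarrow> ident A \<in> hom A A"
    and comp_in_hom: "f \<in> hom A B \<Longrightarrow> g \<in> hom B C \<Longrightarrow> f \<cdot> g \<in> hom A C"
    and ident_comp: "f \<in> hom A B \<Longrightarrow> ident A \<cdot> f = f"
    and comp_ident: "f \<in> hom A B \<Longrightarrow> f \<cdot> ident B = f"
    and comp_assoc: "f \<in> hom A B \<Longrightarrow> g \<in> hom B C \<Longrightarrow> h \<in> hom C D \<Longrightarrow>
      (f \<cdot> g) \<cdot> h = f \<cdot> (g \<cdot> h)"
begin

definition inverse_arrows :: "'o \<Rightarrow> 'o \<Rightarrow> 'm \<Rightarrow> 'm \<Rightarrow> bool" where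
  "inverse_arrows A B f g \<longleftrightarrow>
     f \<in> hom A B \<and> g \<in> hom B A \<and> f \<cdot> g = ident A \<and> g \<cdot> f = ident B"

definition iso :: "'o \<Rightarrow> 'o \<Rightarrow> 'm \<Rightarrow> bool" where
  "iso A B f \<longleftrightarrow> (\<exists>g. inverse_arrows A B f g)"

definition inv_ar :: "'m \<Rightarrow> 'm" where
  "inv_ar f = (THE g. \<exists>A B. inverse_arrows A B f g)"

end

locale symmetric_monoidal_category = category +
  fixes tensor_ob :: "'a \<Rightarrow> 'a \<Rightarrow> 'a"  (infixr "\<otimes>" 75)
    and tensor_ar :: "'b \<Rightarrow> 'b \<Rightarrow> 'b"  (infixr "\<boxtimes>" 75)
    and unit_ob :: "'a"  ("\<I>")
    and assoc :: "'a \<Rightarrow> 'a \<Rightarrow> 'a \<Rightarrow> 'b"  ("\<alpha>")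
    and lunit :: "'a \<Rightarrow> 'b"  ("\<l>")
    and runit :: "'a \<Rightarrow> 'b"  ("\<r>")
    and sym :: "'a \<Rightarrow> 'a \<Rightarrow> 'b"  ("\<sigma>")
  assumes tensor_Ob: "A \<in> Ob \<Longrightarrow> B \<in> Ob \<Longrightarrow> A \<otimes> B \<in> Ob"
    and unit_Ob: "\<I> \<in> Ob"
    and tensor_in_hom: "f \<in> hom A B \<Longrightarrow> g \<in> hom C D \<Longrightarrow> f \<boxtimes> g \<in> hom (A \<otimes> C) (B \<otimes> D)"
    and tensor_ident: "A \<in> Ob \<Longrightarrow> B \<in> Ob \<Longrightarrow> ident A \<boxtimes> ident B = ident (A \<otimes> B)"
    and tensor_comp: "f \<in> hom A B \<Longrightarrow> g \<in> hom B C \<Longrightarrow> h \<in> hom A' B' \<Longrightarrow> k \<in> hom B' C' \<Longrightarrow>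
      (f \<cdot> g) \<boxtimes> (h \<cdot> k) = (f \<boxtimes> h) \<cdot> (g \<boxtimes> k)"
    and assoc_iso: "A \<in> Ob \<Longrightarrow> B \<in> Ob \<Longrightarrow> C \<in> Ob \<Longrightarrow>
      iso ((A \<otimes> B) \<otimes> C) (A \<otimes> (B \<otimes> C)) (\<alpha> A B C)"
    and assoc_natural: "f \<in> hom A A' \<Longrightarrow> g \<in> hom B B' \<Longrightarrow> h \<in> hom C C' \<Longrightarrow>
      ((f \<boxtimes> g) \<boxtimes> h) \<cdot> \<alpha> A' B' C' = \<alpha> A B C \<cdot> (f \<boxtimes> (g \<boxtimes> h))"
    and lunit_iso: "A \<in> Ob \<Longrightarrow> iso (\<I> \<otimes> A) A (\<l> A)"
    and lunit_natural: "f \<in> hom A B \<Longrightarrow> (ident \<I> \<boxtimes> f) \<cdot> \<l> B = \<l> A \<cdot> f"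
    and runit_iso: "A \<in> Ob \<Longrightarrow> iso (A \<otimes> \<I>) A (\<r> A)"
    and runit_natural: "f \<in> hom A B \<Longrightarrow> (f \<boxtimes> ident \<I>) \<cdot> \<r> B = \<r> A \<cdot> f"
    and pentagon: "A \<in> Ob \<Longrightarrow> B \<in> Ob \<Longrightarrow> C \<in> Ob \<Longrightarrow> D \<in> Ob \<Longrightarrow>
      \<alpha> (A \<otimes> B) C D \<cdot> \<alpha> A B (C \<otimes> D) =
      (\<alpha> A B C \<boxtimes> ident D) \<cdot> \<alpha> A (B \<otimes> C) D \<cdot> (ident A \<boxtimes> \<alpha> B C D)"
    and triangle: "A \<in> Ob \<Longrightarrow> B \<in> Ob \<Longrightarrow>
      \<alpha> A \<I> B \<cdot> (ident A \<boxtimes> \<l> B) = \<r> A \<boxtimes> ident B"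
    and sym_in_hom: "A \<in> Ob \<Longrightarrow> B \<in> Ob \<Longrightarrow> \<sigma> A B \<in> hom (A \<otimes> B) (B \<otimes> A)"
    and sym_natural: "f \<in> hom A A' \<Longrightarrow> g \<in> hom B B' \<Longrightarrow>
      (f \<boxtimes> g) \<cdot> \<sigma> A' B' = \<sigma> A B \<cdot> (g \<boxtimes> f)"
    and sym_sym: "A \<in> Ob \<Longrightarrow> B \<in> Ob \<Longrightarrow> \<sigma> A B \<cdot> \<sigma> B A = ident (A \<otimes> B)"
    and sym_unit: "A \<in> Ob \<Longrightarrow> \<sigma> A \<I> \<cdot> \<l> A = \<r> A"
    and hexagon: "A \<in> Ob \<Longrightarrow> B \<in> Ob \<Longrightarrow> C \<in> Ob \<Longrightarrow>
      \<alpha> A B C \<cdot> \<sigma> A (B \<otimes> C) \<cdot> \<alpha> B C A =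
      (\<sigma> A B \<boxtimes> ident C) \<cdot> \<alpha> B A C \<cdot> (ident B \<boxtimes> \<sigma> A C)"
begin

text \<open>The middle-four interchange, from (A \<open>\<otimes>\<close> B) \<open>\<otimes>\<close> (C \<open>\<otimes>\<close> D) to (A \<open>\<otimes>\<close> C) \<open>\<otimes>\<close> (B \<open>\<otimes>\<close> D), i.e.
  the map usually written as the tensor of identities with the symmetry of B and C.\<close>

definition interchange :: "'a \<Rightarrow> 'a \<Rightarrow> 'a \<Rightarrow> 'a \<Rightarrow> 'b" where
  "interchange A B C D =
     \<alpha> A B (C \<otimes> D) \<cdot> (ident A \<boxtimes> inv_ar (\<alpha> B C D)) \<cdot> (ident A \<boxtimes> (\<sigma> B C \<boxtimes> ident D))
       \<cdot> (ident A \<boxtimes> \<alpha> C B D) \<cdot> inv_ar (\<alpha> A C (B \<otimes> D))"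

end

locale additive_symmetric_monoidal_category = symmetric_monoidal_category +
  fixes plus_ar :: "'b \<Rightarrow> 'b \<Rightarrow> 'b"  (infixl "\<oplus>" 65)
    and zero_ar :: "'a \<Rightarrow> 'a \<Rightarrow> 'b"  ("\<zero>")
  assumes plus_in_hom: "f \<in> hom A B \<Longrightarrow> g \<in> hom A B \<Longrightarrow> f \<oplus> g \<in> hom A B"
    and zero_in_hom: "A \<in> Ob \<Longrightarrow> B \<in> Ob \<Longrightarrow> \<zero> A B \<in> hom A B"
    and plus_assoc: "f \<in> hom A B \<Longrightarrow> g \<in> hom A B \<Longrightarrow> h \<in> hom A B \<Longrightarrow>
      (f \<oplus> g) \<oplus> h = f \<oplus> (g \<oplus> h)"
    and plus_comm: "f \<in> hom A B \<Longrightarrow> g \<in> hom A B \<Longrightarrow> f \<oplus> g = g \<oplus> f"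
    and zero_plus: "f \<in> hom A B \<Longrightarrow> \<zero> A B \<oplus> f = f"
    and comp_plus: "f \<in> hom A B \<Longrightarrow> g \<in> hom B C \<Longrightarrow> h \<in> hom B C \<Longrightarrow>
      f \<cdot> (g \<oplus> h) = f \<cdot> g \<oplus> f \<cdot> h"
    and plus_comp: "f \<in> hom A B \<Longrightarrow> g \<in> hom A B \<Longrightarrow> h \<in> hom B C \<Longrightarrow>
      (f \<oplus> g) \<cdot> h = f \<cdot> h \<oplus> g \<cdot> h"
    and comp_zero: "f \<in> hom A B \<Longrightarrow> C \<in> Ob \<Longrightarrow> f \<cdot> \<zero> B C = \<zero> A C"
    and zero_comp: "A \<in> Ob \<Longrightarrow> f \<in> hom B C \<Longrightarrow> \<zero> A B \<cdot> f = \<zero> A C"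
    and tensor_plus: "f \<in> hom A B \<Longrightarrow> g \<in> hom C D \<Longrightarrow> h \<in> hom C D \<Longrightarrow>
      f \<boxtimes> (g \<oplus> h) = f \<boxtimes> g \<oplus> f \<boxtimes> h"
    and plus_tensor: "f \<in> hom A B \<Longrightarrow> g \<in> hom A B \<Longrightarrow> h \<in> hom C D \<Longrightarrow>
      (f \<oplus> g) \<boxtimes> h = f \<boxtimes> h \<oplus> g \<boxtimes> h"
    and tensor_zero: "f \<in> hom A B \<Longrightarrow> C \<in> Ob \<Longrightarrow> D \<in> Ob \<Longrightarrow>
      f \<boxtimes> \<zero> C D = \<zero> (A \<otimes> C) (B \<otimes> D)"
    and zero_tensor: "A \<in> Ob \<Longrightarrow> B \<in> Ob \<Longrightarrow> f \<in> hom C D \<Longrightarrow>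
      \<zero> A B \<boxtimes> f = \<zero> (A \<otimes> C) (B \<otimes> D)"


section \<open>Coalgebra modalities\<close>

locale coalgebra_modality = symmetric_monoidal_category +
  fixes bang_ob :: "'a \<Rightarrow> 'a"  ("!\<^sub>o _" [90] 90)
    and bang_ar :: "'b \<Rightarrow> 'b"  ("!\<^sub>a _" [90] 90)
    and comult :: "'a \<Rightarrow> 'b"  ("\<rho>")
    and counit :: "'a \<Rightarrow> 'b"  ("\<epsilon>")
    and copy :: "'a \<Rightarrow> 'b"  ("\<Delta>")
    and discard :: "'a \<Rightarrow> 'b"  ("\<e>")
  assumes bang_Ob: "A \<in> Ob \<Longrightarrow> !\<^sub>o A \<in> Ob"
    and bang_in_hom: "f \<in> hom A B \<Longrightarrow> !\<^sub>a f \<in> hom (!\<^sub>o A) (!\<^sub>o B)"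
    and bang_ident: "A \<in> Ob \<Longrightarrow> !\<^sub>a (ident A) = ident (!\<^sub>o A)"
    and bang_comp: "f \<in> hom A B \<Longrightarrow> g \<in> hom B C \<Longrightarrow> !\<^sub>a (f \<cdot> g) = !\<^sub>a f \<cdot> !\<^sub>a g"
    and comult_in_hom: "A \<in> Ob \<Longrightarrow> \<rho> A \<in> hom (!\<^sub>o A) (!\<^sub>o (!\<^sub>o A))"
    and comult_natural: "f \<in> hom A B \<Longrightarrow> !\<^sub>a f \<cdot> \<rho> B = \<rho> A \<cdot> !\<^sub>a (!\<^sub>a f)"
    and counit_in_hom: "A \<in> Ob \<Longrightarrow> \<epsilon> A \<in> hom (!\<^sub>o A) A"
    and counit_natural: "f \<in> hom A B \<Longrightarrow> !\<^sub>a f \<cdot> \<epsilon> B = \<epsilon> A \<cdot> f"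
    and copy_in_hom: "A \<in> Ob \<Longrightarrow> \<Delta> A \<in> hom (!\<^sub>o A) (!\<^sub>o A \<otimes> !\<^sub>o A)"
    and copy_natural: "f \<in> hom A B \<Longrightarrow> !\<^sub>a f \<cdot> \<Delta> B = \<Delta> A \<cdot> (!\<^sub>a f \<boxtimes> !\<^sub>a f)"
    and discard_in_hom: "A \<in> Ob \<Longrightarrow> \<e> A \<in> hom (!\<^sub>o A) \<I>"
    and discard_natural: "f \<in> hom A B \<Longrightarrow> !\<^sub>a f \<cdot> \<e> B = \<e> A"
    and comonad_counit_left: "A \<in> Ob \<Longrightarrow> \<rho> A \<cdot> \<epsilon> (!\<^sub>o A) = ident (!\<^sub>o A)"
    and comonad_counit_right: "A \<in> Ob \<Longrightarrow> \<rho> A \<cdot> !\<^sub>a (\<epsilon> A) = ident (!\<^sub>o A)"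
    and comonad_coassoc: "A \<in> Ob \<Longrightarrow> \<rho> A \<cdot> \<rho> (!\<^sub>o A) = \<rho> A \<cdot> !\<^sub>a (\<rho> A)"
    and comonoid_coassoc: "A \<in> Ob \<Longrightarrow>
      \<Delta> A \<cdot> (\<Delta> A \<boxtimes> ident (!\<^sub>o A)) \<cdot> \<alpha> (!\<^sub>o A) (!\<^sub>o A) (!\<^sub>o A) = \<Delta> A \<cdot> (ident (!\<^sub>o A) \<boxtimes> \<Delta> A)"
    and comonoid_counit_left: "A \<in> Ob \<Longrightarrow>
      \<Delta> A \<cdot> (\<e> A \<boxtimes> ident (!\<^sub>o A)) \<cdot> \<l> (!\<^sub>o A) = ident (!\<^sub>o A)"
    and comonoid_counit_right: "A \<in> Ob \<Longrightarrow>
      \<Delta> A \<cdot> (ident (!\<^sub>o A) \<boxtimes> \<e> A) \<cdot> \<r> (!\<^sub>o A) = ident (!\<^sub>o A)"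
    and comonoid_cocommutative: "A \<in> Ob \<Longrightarrow> \<Delta> A \<cdot> \<sigma> (!\<^sub>o A) (!\<^sub>o A) = \<Delta> A"
    and comult_copy: "A \<in> Ob \<Longrightarrow> \<rho> A \<cdot> \<Delta> (!\<^sub>o A) = \<Delta> A \<cdot> (\<rho> A \<boxtimes> \<rho> A)"
    and comult_discard: "A \<in> Ob \<Longrightarrow> \<rho> A \<cdot> \<e> (!\<^sub>o A) = \<e> A"

locale monoidal_coalgebra_modality = coalgebra_modality +
  fixes mon :: "'a \<Rightarrow> 'a \<Rightarrow> 'b"  ("\<m>")
    and mon_unit :: "'b"  ("\<m>\<^sub>I")
  assumes mon_in_hom: "A \<in> Ob \<Longrightarrow> B \<in> Ob \<Longrightarrow> \<m> A B \<in> hom (!\<^sub>o A \<otimes> !\<^sub>o B) (!\<^sub>o (A \<otimes> B))"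
    and mon_unit_in_hom: "\<m>\<^sub>I \<in> hom \<I> (!\<^sub>o \<I>)"
    and mon_natural: "f \<in> hom A A' \<Longrightarrow> g \<in> hom B B' \<Longrightarrow>
      (!\<^sub>a f \<boxtimes> !\<^sub>a g) \<cdot> \<m> A' B' = \<m> A B \<cdot> !\<^sub>a (f \<boxtimes> g)"
    \<comment> \<open>\<open>(!, \<m>, \<m>\<^sub>I)\<close> is a symmetric monoidal functor\<close>
    and mon_assoc: "A \<in> Ob \<Longrightarrow> B \<in> Ob \<Longrightarrow> C \<in> Ob \<Longrightarrow>
      (\<m> A B \<boxtimes> ident (!\<^sub>o C)) \<cdot> \<m> (A \<otimes> B) C \<cdot> !\<^sub>a (\<alpha> A B C) =
      \<alpha> (!\<^sub>o A) (!\<^sub>o B) (!\<^sub>o C) \<cdot> (ident (!\<^sub>o A) \<boxtimes> \<m> B C) \<cdot> \<m> A (B \<otimes> C)"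
    and mon_lunit: "A \<in> Ob \<Longrightarrow>
      (\<m>\<^sub>I \<boxtimes> ident (!\<^sub>o A)) \<cdot> \<m> \<I> A \<cdot> !\<^sub>a (\<l> A) = \<l> (!\<^sub>o A)"
    and mon_runit: "A \<in> Ob \<Longrightarrow>
      (ident (!\<^sub>o A) \<boxtimes> \<m>\<^sub>I) \<cdot> \<m> A \<I> \<cdot> !\<^sub>a (\<r> A) = \<r> (!\<^sub>o A)"
    and mon_sym: "A \<in> Ob \<Longrightarrow> B \<in> Ob \<Longrightarrow>
      \<m> A B \<cdot> !\<^sub>a (\<sigma> A B) = \<sigma> (!\<^sub>o A) (!\<^sub>o B) \<cdot> \<m> B A"
    \<comment> \<open>\<open>\<rho>\<close>, \<open>\<epsilon>\<close>, \<open>\<Delta>\<close>, \<open>\<e>\<close> are monoidal transformations\<close>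
    and comult_mon: "A \<in> Ob \<Longrightarrow> B \<in> Ob \<Longrightarrow>
      \<m> A B \<cdot> \<rho> (A \<otimes> B) = (\<rho> A \<boxtimes> \<rho> B) \<cdot> \<m> (!\<^sub>o A) (!\<^sub>o B) \<cdot> !\<^sub>a (\<m> A B)"
    and comult_mon_unit: "\<m>\<^sub>I \<cdot> \<rho> \<I> = \<m>\<^sub>I \<cdot> !\<^sub>a \<m>\<^sub>I"
    and counit_mon: "A \<in> Ob \<Longrightarrow> B \<in> Ob \<Longrightarrow> \<m> A B \<cdot> \<epsilon> (A \<otimes> B) = \<epsilon> A \<boxtimes> \<epsilon> B"
    and counit_mon_unit: "\<m>\<^sub>I \<cdot> \<epsilon> \<I> = ident \<I>"
    and copy_mon: "A \<in> Ob \<Longrightarrow> B \<in> Ob \<Longrightarrow>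
      \<m> A B \<cdot> \<Delta> (A \<otimes> B) =
      (\<Delta> A \<boxtimes> \<Delta> B) \<cdot> interchange (!\<^sub>o A) (!\<^sub>o A) (!\<^sub>o B) (!\<^sub>o B) \<cdot> (\<m> A B \<boxtimes> \<m> A B)"
    and copy_mon_unit: "\<m>\<^sub>I \<cdot> \<Delta> \<I> = inv_ar (\<l> \<I>) \<cdot> (\<m>\<^sub>I \<boxtimes> \<m>\<^sub>I)"
    and discard_mon: "A \<in> Ob \<Longrightarrow> B \<in> Ob \<Longrightarrow> \<m> A B \<cdot> \<e> (A \<otimes> B) = (\<e> A \<boxtimes> \<e> B) \<cdot> \<l> \<I>"
    and discard_mon_unit: "\<m>\<^sub>I \<cdot> \<e> \<I> = ident \<I>"
    \<comment> \<open>\<open>\<Delta>\<close> and \<open>\<e>\<close> are \<open>!\<close>-coalgebra morphisms\<close>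
    and copy_coalgebra: "A \<in> Ob \<Longrightarrow>
      \<rho> A \<cdot> !\<^sub>a (\<Delta> A) = \<Delta> A \<cdot> (\<rho> A \<boxtimes> \<rho> A) \<cdot> \<m> (!\<^sub>o A) (!\<^sub>o A)"
    and discard_coalgebra: "A \<in> Ob \<Longrightarrow> \<rho> A \<cdot> !\<^sub>a (\<e> A) = \<e> A \<cdot> \<m>\<^sub>I"


section \<open>Differential categories\<close>

locale differential_category = additive_symmetric_monoidal_category + coalgebra_modality +
  fixes deriv :: "'a \<Rightarrow> 'b"  ("\<d>")
  assumes deriv_in_hom: "A \<in> Ob \<Longrightarrow> \<d> A \<in> hom (!\<^sub>o A \<otimes> A) (!\<^sub>o A)"
    and deriv_natural: "f \<in> hom A B \<Longrightarrow> (!\<^sub>a f \<boxtimes> f) \<cdot> \<d> B = \<d> A \<cdot> !\<^sub>a f"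
    and deriv_constant: "A \<in> Ob \<Longrightarrow> \<d> A \<cdot> \<e> A = \<zero> (!\<^sub>o A \<otimes> A) \<I>"
    and deriv_Leibniz: "A \<in> Ob \<Longrightarrow>
      \<d> A \<cdot> \<Delta> A =
        (\<Delta> A \<boxtimes> ident A) \<cdot> \<alpha> (!\<^sub>o A) (!\<^sub>o A) A \<cdot> (ident (!\<^sub>o A) \<boxtimes> \<sigma> (!\<^sub>o A) A)
          \<cdot> inv_ar (\<alpha> (!\<^sub>o A) A (!\<^sub>o A)) \<cdot> (\<d> A \<boxtimes> ident (!\<^sub>o A))
        \<oplus> (\<Delta> A \<boxtimes> ident A) \<cdot> \<alpha> (!\<^sub>o A) (!\<^sub>o A) A \<cdot> (ident (!\<^sub>o A) \<boxtimes> \<d> A)"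
    and deriv_linear: "A \<in> Ob \<Longrightarrow> \<d> A \<cdot> \<epsilon> A = (\<e> A \<boxtimes> ident A) \<cdot> \<l> A"
    and deriv_chain: "A \<in> Ob \<Longrightarrow>
      \<d> A \<cdot> \<rho> A = (\<Delta> A \<boxtimes> ident A) \<cdot> \<alpha> (!\<^sub>o A) (!\<^sub>o A) A \<cdot> (\<rho> A \<boxtimes> \<d> A) \<cdot> \<d> (!\<^sub>o A)"
    and deriv_interchange: "A \<in> Ob \<Longrightarrow>
      (\<d> A \<boxtimes> ident A) \<cdot> \<d> A =
        \<alpha> (!\<^sub>o A) A A \<cdot> (ident (!\<^sub>o A) \<boxtimes> \<sigma> A A) \<cdot> inv_ar (\<alpha> (!\<^sub>o A) A A)
          \<cdot> (\<d> A \<boxtimes> ident A) \<cdot> \<d> A"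
begin

definition coderiv :: "'a \<Rightarrow> 'b"  ("\<d>\<degree>") where
  "\<d>\<degree> A = \<Delta> A \<cdot> (ident (!\<^sub>o A) \<boxtimes> \<epsilon> A)"

definition K :: "'a \<Rightarrow> 'b" where
  "K A = \<d>\<degree> A \<cdot> \<d> A \<oplus> !\<^sub>a (\<zero> A A)"

definition has_antiderivatives :: bool where
  "has_antiderivatives \<longleftrightarrow>
     (\<forall>A\<in>Ob. iso (!\<^sub>o A) (!\<^sub>o A) (K A)) \<and>
     (\<forall>A B. \<forall>f\<in>hom A B. !\<^sub>a f \<cdot> K B = K A \<cdot> !\<^sub>a f)"

end

locale differential_linear_category = differential_category + monoidal_coalgebra_modality

locale differential_linear_category_with_antiderivatives = differential_linear_category +
  assumes has_antiderivatives: has_antiderivatives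


section \<open>Complete semirings\<close>

text \<open>
  The sort \<open>{semiring_0, monoid_mult}\<close> is that of unital semirings; unlike \<open>semiring_1\<close> it does not
  exclude the trivial semiring. The type \<open>'i\<close> plays the role of the universe from which index sets
  are drawn. A sum depends only on the family restricted to its index set (\<open>csum_cong\<close>), and the
  blocks of a partition may be empty. Invariance under reindexing along a bijection between subsets
  of \<open>'i\<close> is the case of \<open>csum_partition\<close> in which all blocks are singletons.
\<close>

locale complete_semiring =
  fixes csum :: "('i \<Rightarrow> 'r::{semiring_0, monoid_mult}) \<Rightarrow> 'i set \<Rightarrow> 'r"
  assumes csum_cong: "(\<And>i. i \<in> I \<Longrightarrow> r i = s i) \<Longrightarrow> csum r I = csum s I"
    and csum_finite: "finite I \<Longrightarrow> csum r I = (\<Sum>i\<in>I. r i)"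
    and csum_partition: "disjoint_family_on P J \<Longrightarrow>
      csum r (\<Union>j\<in>J. P j) = csum (\<lambda>j. csum r (P j)) J"
    and csum_distrib_left: "a * csum r I = csum (\<lambda>i. a * r i) I"
    and csum_distrib_right: "csum r I * a = csum (\<lambda>i. r i * a) I"


section \<open>The category of sets and matrices over a complete semiring\<close>

text \<open>
  The objects have to form a collection of sets closed under binary products, finite multisets and
  a singleton. They are taken to be all subsets of the following type, which is closed under pairing
  and formation of bags; every set of elements of any type \<open>'a\<close> occurs among them up to the
  bijection \<open>Atom\<close>.
\<close>

datatype 'a elem =
    Atom 'a
  | Star
  | Pair (pfst: "'a elem") (psnd: "'a elem")
  | Bag (bag: "'a elem multiset")

text \<open>
  An arrow from \<open>X\<close> to \<open>Y\<close> is a function \<open>X \<times> Y \<rightarrow> R\<close> together with \<open>X\<close> and \<open>Y\<close>. As \<open>HOL\<close> functions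
  are total, \<open>entry\<close> is required to vanish outside \<open>X \<times> Y\<close>, so that equality of arrows is equality
  of functions on \<open>X \<times> Y\<close>. All arrows below are built with \<open>mat\<close>, hence their defining
  formulas only matter for row and column indices in the source and target.
\<close>

datatype ('e, 'r) matrix = Matrix (source: "'e set") (target: "'e set") (entry: "'e \<Rightarrow> 'e \<Rightarrow> 'r")

definition mat :: "'e set \<Rightarrow> 'e set \<Rightarrow> ('e \<Rightarrow> 'e \<Rightarrow> 'r::zero) \<Rightarrow> ('e, 'r) matrix" where
  "mat X Y f = Matrix X Y (\<lambda>x y. if x \<in> X \<and> y \<in> Y then f x y else 0)"

definition \<delta> :: "'e \<Rightarrow> 'e \<Rightarrow> 'r::{zero, one}" where
  "\<delta> x y = (if x = y then 1 else 0)"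

text \<open>The matrix of a function, used for the structural isomorphisms.\<close>

definition graph_mat :: "'e set \<Rightarrow> 'e set \<Rightarrow> ('e \<Rightarrow> 'e) \<Rightarrow> ('e, 'r::{zero, one}) matrix" where
  "graph_mat X Y h = mat X Y (\<lambda>x y. \<delta> (h x) y)"

text \<open>The sum of \<open>n\<close> copies of 1; \<open>of_nat\<close> would require \<open>0 \<noteq> 1\<close>.\<close>

definition nat_sum :: "nat \<Rightarrow> 'r::{comm_monoid_add, one}" where
  "nat_sum n = (\<Sum>i<n. 1)"

type_synonym ('a, 'r) arrow = "('a elem, 'r) matrix"

definition RPi_hom :: "'a elem set \<Rightarrow> 'a elem set \<Rightarrow> ('a, 'r::zero) arrow set" where
  "RPi_hom X Y = {f. source f = X \<and> target f = Y \<and>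
     (\<forall>x y. \<not> (x \<in> X \<and> y \<in> Y) \<longrightarrow> entry f x y = 0)}"

definition RPi_ident :: "'a elem set \<Rightarrow> ('a, 'r::{zero, one}) arrow" where
  "RPi_ident X = mat X X \<delta>"

definition RPi_comp :: "(('a elem \<Rightarrow> 'r) \<Rightarrow> 'a elem set \<Rightarrow> 'r) \<Rightarrow>
    ('a, 'r::{zero, times}) arrow \<Rightarrow> ('a, 'r) arrow \<Rightarrow> ('a, 'r) arrow" where
  "RPi_comp csum f g = mat (source f) (target g)
     (\<lambda>x z. csum (\<lambda>y. entry f x y * entry g y z) (target f))"

definition RPi_plus ::
    "('a, 'r::{zero, plus}) arrow \<Rightarrow> ('a, 'r) arrow \<Rightarrow> ('a, 'r) arrow" where
  "RPi_plus f g = mat (source f) (target f) (\<lambda>x y. entry f x y + entry g x y)"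

definition RPi_zero :: "'a elem set \<Rightarrow> 'a elem set \<Rightarrow> ('a, 'r::zero) arrow" where
  "RPi_zero X Y = mat X Y (\<lambda>x y. 0)"

definition RPi_tensor_ob :: "'a elem set \<Rightarrow> 'a elem set \<Rightarrow> 'a elem set" where
  "RPi_tensor_ob X Y = {Pair x y | x y. x \<in> X \<and> y \<in> Y}"

definition RPi_tensor_ar ::
    "('a, 'r::{zero, times}) arrow \<Rightarrow> ('a, 'r) arrow \<Rightarrow> ('a, 'r) arrow" where
  "RPi_tensor_ar f g =
     mat (RPi_tensor_ob (source f) (source g)) (RPi_tensor_ob (target f) (target g))
       (\<lambda>u v. entry f (pfst u) (pfst v) * entry g (psnd u) (psnd v))"

definition RPi_unit :: "'a elem set" where
  "RPi_unit = {Star}"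

definition RPi_assoc ::
    "'a elem set \<Rightarrow> 'a elem set \<Rightarrow> 'a elem set \<Rightarrow> ('a, 'r::{zero, one}) arrow" where
  "RPi_assoc X Y Z =
     graph_mat (RPi_tensor_ob (RPi_tensor_ob X Y) Z) (RPi_tensor_ob X (RPi_tensor_ob Y Z))
       (\<lambda>u. Pair (pfst (pfst u)) (Pair (psnd (pfst u)) (psnd u)))"

definition RPi_lunit :: "'a elem set \<Rightarrow> ('a, 'r::{zero, one}) arrow" where
  "RPi_lunit X = graph_mat (RPi_tensor_ob RPi_unit X) X psnd"

definition RPi_runit :: "'a elem set \<Rightarrow> ('a, 'r::{zero, one}) arrow" where
  "RPi_runit X = graph_mat (RPi_tensor_ob X RPi_unit) X pfst"

definition RPi_sym :: "'a elem set \<Rightarrow> 'a elem set \<Rightarrow> ('a, 'r::{zero, one}) arrow" where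
  "RPi_sym X Y = graph_mat (RPi_tensor_ob X Y) (RPi_tensor_ob Y X) (\<lambda>u. Pair (psnd u) (pfst u))"

definition RPi_bang_ob :: "'a elem set \<Rightarrow> 'a elem set" where
  "RPi_bang_ob X = {Bag M | M. set_mset M \<subseteq> X}"

text \<open>
  The value at a bag \<open>q\<close> is computed from an arbitrary enumeration \<open>ys\<close> of \<open>q\<close>; it does not depend on
  the choice, since permuting \<open>ys\<close> permutes the tuples \<open>xs\<close>. The sum over \<open>xs\<close> is finite.
\<close>

definition RPi_bang_ar ::
    "('a, 'r::{comm_monoid_add, comm_monoid_mult}) arrow \<Rightarrow> ('a, 'r) arrow" where
  "RPi_bang_ar f = mat (RPi_bang_ob (source f)) (RPi_bang_ob (target f))
     (\<lambda>p q. let ys = (SOME ys. mset ys = bag q) in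
        \<Sum>xs | length xs = length ys \<and> mset xs = bag p. \<Prod>i<length ys. entry f (xs ! i) (ys ! i))"

definition RPi_counit :: "'a elem set \<Rightarrow> ('a, 'r::{zero, one}) arrow" where
  "RPi_counit X = mat (RPi_bang_ob X) X (\<lambda>p x. \<delta> p (Bag {#x#}))"

definition RPi_comult :: "'a elem set \<Rightarrow> ('a, 'r::{zero, one}) arrow" where
  "RPi_comult X = mat (RPi_bang_ob X) (RPi_bang_ob (RPi_bang_ob X))
     (\<lambda>p P. \<delta> p (Bag (\<Sum>q\<in>#bag P. bag q)))"

definition RPi_copy :: "'a elem set \<Rightarrow> ('a, 'r::{zero, one}) arrow" where
  "RPi_copy X = mat (RPi_bang_ob X) (RPi_tensor_ob (RPi_bang_ob X) (RPi_bang_ob X))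
     (\<lambda>p u. \<delta> p (Bag (bag (pfst u) + bag (psnd u))))"

definition RPi_discard :: "'a elem set \<Rightarrow> ('a, 'r::{zero, one}) arrow" where
  "RPi_discard X = mat (RPi_bang_ob X) RPi_unit (\<lambda>p _. \<delta> p (Bag {#}))"

definition RPi_mon :: "'a elem set \<Rightarrow> 'a elem set \<Rightarrow> ('a, 'r::{zero, one, times}) arrow" where
  "RPi_mon X Y =
     mat (RPi_tensor_ob (RPi_bang_ob X) (RPi_bang_ob Y)) (RPi_bang_ob (RPi_tensor_ob X Y))
       (\<lambda>u b. \<delta> (pfst u) (Bag (image_mset pfst (bag b))) *
              \<delta> (psnd u) (Bag (image_mset psnd (bag b))))"

definition RPi_mon_unit :: "('a, 'r::{zero, one}) arrow" where
  "RPi_mon_unit = mat RPi_unit (RPi_bang_ob RPi_unit) (\<lambda>_ _. 1)"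

text \<open>
  At \<open>([x\<^sub>1,\<dots>,x\<^sub>n], x)\<close> and \<open>q = [x\<^sub>1,\<dots>,x\<^sub>n,x]\<close> the coefficient is the number of occurrences of the
  inserted element \<open>x\<close> in \<open>q\<close>. The total number \<open>n + 1\<close> of elements of \<open>q\<close> cannot be used here:
  with it, the Leibniz rule fails, and so does naturality when \<open>2\<close> is invertible, unless \<open>1 + 1 = 1\<close>. For instance,
  for distinct \<open>x\<close>, \<open>y\<close>, the Leibniz rule at \<open>(([y], x), ([x], [y]))\<close> would read \<open>1 + 1 = 1\<close>.
  (If \<open>1 + 1 = 1\<close>, the two coefficients agree.)
\<close>

definition RPi_deriv :: "'a elem set \<Rightarrow> ('a, 'r::{comm_monoid_add, one, times}) arrow" where
  "RPi_deriv X = mat (RPi_tensor_ob (RPi_bang_ob X) X) (RPi_bang_ob X)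
     (\<lambda>u q. nat_sum (count (bag q) (psnd u)) *
            \<delta> (Bag (add_mset (psnd u) (bag (pfst u)))) q)"

end

theory Submission
  imports Defs
begin

text \<open>
  A function \<open>h : Y \<rightarrow> X\<close> can be read backwards as the 0/1 matrix from \<open>X\<close> to \<open>Y\<close> with entries
  \<open>\<delta> x (h y)\<close>, its cograph. Composition, tensor product and \<open>!\<close> of cographs are again cographs,
  of the composite, of the product and of the image map on bags. Apart from \<open>\<d>\<close>, every structural
  map is a cograph: \<open>\<epsilon>\<close>, \<open>\<rho>\<close>, \<open>\<Delta>\<close>, \<open>\<e>\<close> come from the formation of one-element bags,
  the sum of a bag of bags, the sum of two bags and the empty bag, \<open>\<m>\<close> from the two projections of
  a bag of pairs, \<open>\<m>\<^sub>I\<close> from a constant map, and the isomorphisms from their inverses.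
  Hence every axiom that involves neither an arbitrary arrow nor \<open>\<d>\<close> is an equation between
  functions on pairs and bags, which expresses a property of the free commutative monoid.

  For an arbitrary matrix \<open>f\<close>, the matrix \<open>!f\<close> is controlled by its interaction with
  \<open>uncons : !X \<rightarrow> X \<otimes> !X\<close>, the cograph of the insertion of one element. The column of \<open>!f\<close> at
  \<open>y + q\<close> is the convolution of the column of \<open>f\<close> at \<open>y\<close> with the column of \<open>!f\<close> at \<open>q\<close>, that is,
  \<open>!f \<cdot> uncons = uncons \<cdot> (f \<otimes> !f)\<close> (\<open>bang_uncons\<close>). An arrow \<open>M\<close> into \<open>!Y\<close> is determined by
  \<open>M \<cdot> \<e>\<close>, its column at the empty bag, and by an equation that expresses \<open>M \<cdot> uncons\<close> through \<open>M\<close>,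
  by induction on the bag that indexes a column (\<open>arrow_to_bang_eqI\<close> and its variants).
  Functoriality of \<open>!\<close> and naturality of \<open>\<rho>\<close>, \<open>\<Delta>\<close>, \<open>\<m>\<close> and \<open>\<d>\<close> follow by checking that both
  sides satisfy the same recursion.

  The row of \<open>\<d>\<close> at \<open>(p, x)\<close> vanishes except at \<open>q = p + x\<close>, where the entry is the multiplicity
  of \<open>x\<close> in \<open>q\<close>. So the differential axioms reduce to facts about multiplicities: they are additive
  in \<open>q\<close> (Leibniz rule), they satisfy
  \<open>count (\<Sum>t\<in>#P. t) x = \<Sum>t. count P t * count t x\<close> (chain rule), and the product of the
  multiplicities met when \<open>x\<close> and \<open>y\<close> are inserted is symmetric in them (interchange rule).

  Finally, \<open>\<d>\<degree> \<cdot> \<d>\<close> removes an element from a bag \<open>q\<close> and puts it back. It is diagonal with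
  entry \<open>\<Sum>x. count q x\<close>, the size of \<open>q\<close>, while \<open>!(0)\<close> contributes 1 at the empty bag. Thus \<open>K\<close> is
  diagonal with entries among 1, 2, 3, \<dots>, which are invertible by assumption. It is natural because
  the entries of \<open>!f\<close> vanish between bags of different sizes (\<open>has_antiderivatives\<close>).
\<close>

section \<open>Sums in a complete semiring\<close>

context complete_semiring
begin

lemma csum_zero: "csum (\<lambda>i. 0) I = 0"
  using csum_distrib_left[of 0 "\<lambda>i. 0" I] by simp

lemma csum_eq_zero: "(\<And>i. i \<in> I \<Longrightarrow> r i = 0) \<Longrightarrow> csum r I = 0"
  using csum_cong[of I r "\<lambda>i. 0"] csum_zero by simp

text \<open>The partition axiom indexes the blocks by the same type as the summands, so two nonempty
  blocks are labelled by one element of each.\<close>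

lemma csum_Un_disjoint:
  assumes "A \<inter> B = {}"
  shows "csum r (A \<union> B) = csum r A + csum r B"
proof (cases "A = {} \<or> B = {}")
  case True
  then show ?thesis by (auto simp: csum_finite)
next
  case False
  then obtain a b where ab: "a \<in> A" "b \<in> B" by blast
  then have "a \<noteq> b" using assms by blast
  define P where "P = (\<lambda>i. if i = a then A else B)"
  have "disjoint_family_on P {a, b}"
    using assms by (auto simp: disjoint_family_on_def P_def)
  from csum_partition[OF this, of r] show ?thesis
    using \<open>a \<noteq> b\<close> by (simp add: P_def csum_finite Un_commute)
qed

lemma csum_mono_neutral:
  assumes "J \<subseteq> I" "\<And>i. i \<in> I \<Longrightarrow> i \<notin> J \<Longrightarrow> r i = 0"
  shows "csum r I = csum r J"
proof -
  have "csum r I = csum r (J \<union> (I - J))"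
    using assms(1) by (simp add: Un_absorb1)
  also have "\<dots> = csum r J + csum r (I - J)"
    by (rule csum_Un_disjoint) blast
  also have "csum r (I - J) = 0"
    using assms(2) by (intro csum_eq_zero) auto
  finally show ?thesis by simp
qed

lemma csum_eq_single:
  assumes "a \<in> I" "\<And>i. i \<in> I \<Longrightarrow> i \<noteq> a \<Longrightarrow> r i = 0"
  shows "csum r I = r a"
  using csum_mono_neutral[of "{a}" I r] assms by (simp add: csum_finite)

lemma csum_reindex:
  assumes "bij_betw h J I"
  shows "csum r I = csum (\<lambda>j. r (h j)) J"
proof -
  have "disjoint_family_on (\<lambda>j. {h j}) J"
    using assms by (auto simp: disjoint_family_on_def bij_betw_def inj_on_def)
  moreover have "I = (\<Union>j\<in>J. {h j})"
    using assms by (auto simp: bij_betw_def)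
  ultimately show ?thesis
    using csum_partition[of "\<lambda>j. {h j}" J r] by (simp add: csum_finite)
qed

end

section \<open>Iterated sums over the universe of elements\<close>

lemma Pair_in_tensor_ob [simp]: "Pair x y \<in> RPi_tensor_ob X Y \<longleftrightarrow> x \<in> X \<and> y \<in> Y"
  by (simp add: RPi_tensor_ob_def)

lemma Ball_tensor_ob [simp]:
  "(\<forall>u\<in>RPi_tensor_ob X Y. P u) \<longleftrightarrow> (\<forall>x\<in>X. \<forall>y\<in>Y. P (Pair x y))"
  by (auto simp: RPi_tensor_ob_def)

lemma Bag_in_bang_ob [simp]: "Bag M \<in> RPi_bang_ob X \<longleftrightarrow> set_mset M \<subseteq> X"
  by (simp add: RPi_bang_ob_def)

lemma Ball_bang_ob [simp]:
  "(\<forall>p\<in>RPi_bang_ob X. P p) \<longleftrightarrow> (\<forall>M. set_mset M \<subseteq> X \<longrightarrow> P (Bag M))"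
  by (auto simp: RPi_bang_ob_def)

lemma Star_in_unit [simp]: "Star \<in> RPi_unit"
  by (simp add: RPi_unit_def)

lemma Ball_unit [simp]: "(\<forall>u\<in>RPi_unit. P u) \<longleftrightarrow> P Star"
  by (simp add: RPi_unit_def)

locale elem_complete_semiring = complete_semiring csum
  for csum :: "('a elem \<Rightarrow> 'r::{comm_semiring_0, comm_monoid_mult}) \<Rightarrow> 'a elem set \<Rightarrow> 'r"
begin

text \<open>A double sum is a sum over a product set, which is again a set of indices of the same type.
  This is what makes sums over different index sets commute.\<close>

lemma csum_tensor_ob:
  "csum r (RPi_tensor_ob X Y) = csum (\<lambda>x. csum (\<lambda>y. r (Pair x y)) Y) X"
proof -
  have "disjoint_family_on (\<lambda>x. Pair x ` Y) X"
    by (auto simp: disjoint_family_on_def)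
  moreover have "RPi_tensor_ob X Y = (\<Union>x\<in>X. Pair x ` Y)"
    by (auto simp: RPi_tensor_ob_def)
  moreover have "csum r (Pair x ` Y) = csum (\<lambda>y. r (Pair x y)) Y" for x
    by (intro csum_reindex) (auto simp: bij_betw_def inj_on_def)
  ultimately show ?thesis
    using csum_partition[of "\<lambda>x. Pair x ` Y" X r] by simp
qed

lemma csum_swap:
  "csum (\<lambda>x. csum (r x) Y) X = csum (\<lambda>y. csum (\<lambda>x. r x y) X) Y"
proof -
  have "csum (\<lambda>x. csum (r x) Y) X = csum (\<lambda>u. r (pfst u) (psnd u)) (RPi_tensor_ob X Y)"
    by (simp add: csum_tensor_ob)
  also have "\<dots> = csum (\<lambda>u. r (psnd u) (pfst u)) (RPi_tensor_ob Y X)"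
    by (subst csum_reindex[where h = "\<lambda>u. Pair (psnd u) (pfst u)" and J = "RPi_tensor_ob Y X"])
      (auto simp: RPi_tensor_ob_def intro!: bij_betwI[where g = "\<lambda>u. Pair (psnd u) (pfst u)"])
  finally show ?thesis
    by (simp add: csum_tensor_ob)
qed

text \<open>A sum of two terms is itself a sum over an index set, here one with the two elements
  \<open>Star\<close> and \<open>Bag {#}\<close>, so additivity is an exchange of two sums.\<close>

lemma csum_add: "csum (\<lambda>x. r x + s x) X = csum r X + csum s X"
  using csum_swap[of "\<lambda>x i. if i = Star then r x else s x" "{Star, Bag {#}}" X]
  by (simp add: csum_finite)

end

section \<open>The calculus of matrices\<close>

lemma source_mat [simp]: "source (mat X Y f) = X"
  and target_mat [simp]: "target (mat X Y f) = Y"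
  and entry_mat: "entry (mat X Y f) x y = (if x \<in> X \<and> y \<in> Y then f x y else 0)"
  by (simp_all add: mat_def)

lemma entry_mat' [simp]: "x \<in> X \<Longrightarrow> y \<in> Y \<Longrightarrow> entry (mat X Y f) x y = f x y"
  by (simp add: entry_mat)

lemma mat_eqI:
  "X = X' \<Longrightarrow> Y = Y' \<Longrightarrow> \<forall>x\<in>X. \<forall>y\<in>Y. f x y = g x y \<Longrightarrow> mat X Y f = mat X' Y' g"
  by (auto simp: mat_def fun_eq_iff)

lemma RPi_hom_iff_mat: "f \<in> RPi_hom X Y \<longleftrightarrow> source f = X \<and> target f = Y \<and> mat X Y (entry f) = f"
  by (cases f) (auto simp: RPi_hom_def mat_def fun_eq_iff)

lemma mat_in_hom [simp]: "mat X Y f \<in> RPi_hom X Y"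
  by (auto simp: RPi_hom_def entry_mat)

lemma arrow_eqI:
  assumes "f \<in> RPi_hom X Y" "g \<in> RPi_hom X Y" "\<forall>x\<in>X. \<forall>y\<in>Y. entry f x y = entry g x y"
  shows "f = g"
  using assms mat_eqI[of X X Y Y "entry f" "entry g"] by (simp add: RPi_hom_iff_mat)

lemma source_hom: "f \<in> RPi_hom X Y \<Longrightarrow> source f = X"
  and target_hom: "f \<in> RPi_hom X Y \<Longrightarrow> target f = Y"
  by (simp_all add: RPi_hom_def)

lemma delta_simps [simp]:
  "\<delta> x x = 1"
  "x \<noteq> y \<Longrightarrow> \<delta> x y = 0"
  by (simp_all add: \<delta>_def)

lemma delta_mult_delta: "\<delta> a b * \<delta> c d = (\<delta> (Pair a c) (Pair b d) :: 'r::{semiring_0, monoid_mult})"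
  by (simp add: \<delta>_def)

lemma source_tensor [simp]:
    "source (RPi_tensor_ar f g) = RPi_tensor_ob (source f) (source g)"
  and target_tensor [simp]:
    "target (RPi_tensor_ar f g) = RPi_tensor_ob (target f) (target g)"
  by (simp_all add: RPi_tensor_ar_def)

lemma source_plus [simp]: "source (RPi_plus f g) = source f"
  and target_plus [simp]: "target (RPi_plus f g) = target f"
  by (simp_all add: RPi_plus_def)

lemma source_bang [simp]: "source (RPi_bang_ar f) = RPi_bang_ob (source f)"
  and target_bang [simp]: "target (RPi_bang_ar f) = RPi_bang_ob (target f)"
  by (simp_all add: RPi_bang_ar_def)

text \<open>This is a contravariant functor from sets to matrices. Its values include all structural maps
  other than the deriving transformation.\<close>

definition cograph :: "'e set \<Rightarrow> 'e set \<Rightarrow> ('e \<Rightarrow> 'e) \<Rightarrow> ('e, 'r::{zero, one}) matrix" where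
  "cograph X Y h = mat X Y (\<lambda>x y. \<delta> x (h y))"

lemma source_cograph [simp]: "source (cograph X Y h) = X"
  and target_cograph [simp]: "target (cograph X Y h) = Y"
  by (simp_all add: cograph_def)

lemma cograph_in_hom [simp]: "cograph X Y h \<in> RPi_hom X Y"
  by (simp add: cograph_def)

lemma cograph_eqI:
  "X = X' \<Longrightarrow> Y = Y' \<Longrightarrow> \<forall>y\<in>Y. h y = k y \<Longrightarrow> cograph X Y h = cograph X' Y' k"
  by (auto simp: cograph_def intro!: mat_eqI)

lemma cograph_tensor:
  "RPi_tensor_ar (cograph X Y h) (cograph X' Y' k) =
   (cograph (RPi_tensor_ob X X') (RPi_tensor_ob Y Y') (\<lambda>u. Pair (h (pfst u)) (k (psnd u)))
     :: ('a, 'r::{semiring_0, monoid_mult}) arrow)"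
  unfolding cograph_def RPi_tensor_ar_def source_mat target_mat
  by (rule mat_eqI) (simp_all add: delta_mult_delta)

text \<open>The structural isomorphisms are given as graphs. Read as cographs of their inverses, they can
  be composed with the other structural maps.\<close>

lemma graph_eq_cograph:
  assumes "\<forall>x\<in>X. h x \<in> Y \<and> k (h x) = x" "\<forall>y\<in>Y. k y \<in> X \<and> h (k y) = y"
  shows "graph_mat X Y h = cograph X Y k"
  unfolding graph_mat_def cograph_def
  by (rule mat_eqI) (use assms in \<open>auto simp: \<delta>_def\<close>)

lemma ident_cograph: "RPi_ident X = cograph X X (\<lambda>x. x)"
  by (simp add: RPi_ident_def cograph_def)

lemma assoc_cograph: "RPi_assoc X Y Z =
    cograph (RPi_tensor_ob (RPi_tensor_ob X Y) Z) (RPi_tensor_ob X (RPi_tensor_ob Y Z))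
      (\<lambda>v. Pair (Pair (pfst v) (pfst (psnd v))) (psnd (psnd v)))"
  unfolding RPi_assoc_def by (rule graph_eq_cograph) simp_all

lemma lunit_cograph: "RPi_lunit X = cograph (RPi_tensor_ob RPi_unit X) X (Pair Star)"
  unfolding RPi_lunit_def by (rule graph_eq_cograph) simp_all

lemma runit_cograph: "RPi_runit X = cograph (RPi_tensor_ob X RPi_unit) X (\<lambda>x. Pair x Star)"
  unfolding RPi_runit_def by (rule graph_eq_cograph) simp_all

lemma sym_cograph: "RPi_sym X Y =
    cograph (RPi_tensor_ob X Y) (RPi_tensor_ob Y X) (\<lambda>v. Pair (psnd v) (pfst v))"
  unfolding RPi_sym_def by (rule graph_eq_cograph) simp_all

lemma counit_cograph: "RPi_counit X = cograph (RPi_bang_ob X) X (\<lambda>x. Bag {#x#})"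
  by (simp add: RPi_counit_def cograph_def)

lemma comult_cograph: "RPi_comult X =
    cograph (RPi_bang_ob X) (RPi_bang_ob (RPi_bang_ob X)) (\<lambda>P. Bag (\<Sum>q\<in>#bag P. bag q))"
  by (simp add: RPi_comult_def cograph_def)

lemma copy_cograph: "RPi_copy X =
    cograph (RPi_bang_ob X) (RPi_tensor_ob (RPi_bang_ob X) (RPi_bang_ob X))
      (\<lambda>u. Bag (bag (pfst u) + bag (psnd u)))"
  by (simp add: RPi_copy_def cograph_def)

lemma discard_cograph: "RPi_discard X = cograph (RPi_bang_ob X) RPi_unit (\<lambda>u. Bag {#})"
  by (simp add: RPi_discard_def cograph_def)

lemma mon_cograph: "(RPi_mon X Y :: ('a, 'r::{semiring_0, monoid_mult}) arrow) =
    cograph (RPi_tensor_ob (RPi_bang_ob X) (RPi_bang_ob Y)) (RPi_bang_ob (RPi_tensor_ob X Y))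
      (\<lambda>b. Pair (Bag (image_mset pfst (bag b))) (Bag (image_mset psnd (bag b))))"
  unfolding RPi_mon_def cograph_def delta_mult_delta by (rule mat_eqI) simp_all

lemma mon_unit_cograph: "RPi_mon_unit = cograph RPi_unit (RPi_bang_ob RPi_unit) (\<lambda>b. Star)"
  unfolding RPi_mon_unit_def cograph_def by (rule mat_eqI) simp_all

lemmas structure_cograph = ident_cograph assoc_cograph lunit_cograph runit_cograph sym_cograph
  counit_cograph comult_cograph copy_cograph discard_cograph mon_cograph mon_unit_cograph

context elem_complete_semiring
begin

abbreviation comp (infixl "\<odot>" 70) where "f \<odot> g \<equiv> RPi_comp csum f g"

abbreviation tensor :: "('a, 'r) arrow \<Rightarrow> ('a, 'r) arrow \<Rightarrow> ('a, 'r) arrow"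
    (infixr "\<boxtimes>" 75)
  where "f \<boxtimes> g \<equiv> RPi_tensor_ar f g"

lemma source_comp [simp]: "source (f \<odot> g) = source f"
  and target_comp [simp]: "target (f \<odot> g) = target g"
  by (simp_all add: RPi_comp_def)

lemma entry_comp:
  "x \<in> source f \<Longrightarrow> z \<in> target g \<Longrightarrow>
    entry (f \<odot> g) x z = csum (\<lambda>y. entry f x y * entry g y z) (target f)"
  by (simp add: RPi_comp_def)

lemma entry_tensor:
  "x \<in> source f \<Longrightarrow> x' \<in> source g \<Longrightarrow> y \<in> target f \<Longrightarrow> y' \<in> target g \<Longrightarrow>
    entry (f \<boxtimes> g) (Pair x x') (Pair y y') = entry f x y * entry g x' y'"
  by (simp add: RPi_tensor_ar_def)

text \<open>As \<open>mat\<close> sets all entries outside source and target to zero, associativity and the interchange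
  law for tensor products only ask for matching sources and targets. In this form they can be used as rewrite
  rules.\<close>

lemma comp_assoc:
  assumes "target f = source g" "target g = source h"
  shows "(f \<odot> g) \<odot> h = f \<odot> (g \<odot> h)"
proof -
  have "csum (\<lambda>y. entry (f \<odot> g) x y * entry h y z) (target g) =
        csum (\<lambda>w. entry f x w * entry (g \<odot> h) w z) (target f)"
    if "x \<in> source f" "z \<in> target h" for x z
  proof -
    have "csum (\<lambda>y. entry (f \<odot> g) x y * entry h y z) (target g) =
        csum (\<lambda>y. csum (\<lambda>w. entry f x w * entry g w y * entry h y z) (target f)) (target g)"
      using that by (intro csum_cong) (simp add: entry_comp csum_distrib_right)
    also have "\<dots> =
        csum (\<lambda>w. csum (\<lambda>y. entry f x w * entry g w y * entry h y z) (target g)) (target f)"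
      by (rule csum_swap)
    also have "\<dots> = csum (\<lambda>w. entry f x w * entry (g \<odot> h) w z) (target f)"
      using that assms by (intro csum_cong) (simp add: entry_comp csum_distrib_left mult.assoc)
    finally show ?thesis .
  qed
  then show ?thesis
    unfolding RPi_comp_def[of csum "f \<odot> g"] RPi_comp_def[of csum f "g \<odot> h"]
    by (auto intro!: mat_eqI)
qed

lemma tensor_comp:
  assumes "target f = source g" "target h = source k"
  shows "(f \<odot> g) \<boxtimes> (h \<odot> k) = (f \<boxtimes> h) \<odot> (g \<boxtimes> k)"
proof -
  have "entry (f \<odot> g) x z * entry (h \<odot> k) x' z' = 
     csum (\<lambda>v. entry (f \<boxtimes> h) (Pair x x') v * entry (g \<boxtimes> k) v (Pair z z'))
       (RPi_tensor_ob (target f) (target h))"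
    if "x \<in> source f" "x' \<in> source h" "z \<in> target g" "z' \<in> target k" for x x' z z'
    using that assms
    unfolding csum_tensor_ob entry_comp[OF that(1,3)] entry_comp[OF that(2,4)]
    by (simp only: csum_distrib_right)
      (auto intro!: csum_cong simp: csum_distrib_left entry_tensor ac_simps)
  then show ?thesis
    unfolding RPi_comp_def[of csum "f \<boxtimes> h"] RPi_tensor_ar_def[of "f \<odot> g"]
    by (intro mat_eqI) simp_all
qed

text \<open>A cograph on the right only reindexes columns, since each of its columns has at most one
  nonzero entry. Likewise a graph on the left only reindexes rows.\<close>

lemma comp_cograph:
  assumes "target f = Y" "\<forall>z\<in>Z. k z \<in> Y"
  shows "f \<odot> cograph Y Z k = mat (source f) Z (\<lambda>x z. entry f x (k z))"
  unfolding RPi_comp_def source_cograph target_cograph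
proof (intro mat_eqI ballI refl)
  fix x z assume "x \<in> source f" "z \<in> Z"
  then have "csum (\<lambda>y. entry f x y * entry (cograph Y Z k) y z) (target f) =
      entry f x (k z) * entry (cograph Y Z k) (k z) z"
    using assms by (intro csum_eq_single) (auto simp: cograph_def)
  then show "csum (\<lambda>y. entry f x y * entry (cograph Y Z k) y z) (target f) = entry f x (k z)"
    using assms \<open>z \<in> Z\<close> by (simp add: cograph_def)
qed

lemma cograph_comp_cograph:
  "\<forall>z\<in>Z. k z \<in> Y \<Longrightarrow> cograph X Y h \<odot> cograph Y Z k = cograph X Z (\<lambda>z. h (k z))"
  by (subst comp_cograph) (auto simp: cograph_def intro!: mat_eqI)

text \<open>The weights \<open>w\<close> are there for the deriving transformation and for diagonal matrices.\<close>

lemma weighted_graph_comp: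
  assumes "source g = Y" "\<forall>x\<in>X. h x \<in> Y"
  shows "mat X Y (\<lambda>x y. w x * \<delta> (h x) y) \<odot> g = mat X (target g) (\<lambda>x z. w x * entry g (h x) z)"
  unfolding RPi_comp_def source_mat target_mat
proof (intro mat_eqI ballI refl)
  fix x z assume "x \<in> X" "z \<in> target g"
  let ?f = "mat X Y (\<lambda>x y. w x * \<delta> (h x) y)"
  have "csum (\<lambda>y. entry ?f x y * entry g y z) Y = entry ?f x (h x) * entry g (h x) z"
    using assms \<open>x \<in> X\<close> by (intro csum_eq_single) (auto simp: entry_mat)
  then show "csum (\<lambda>y. entry ?f x y * entry g y z) Y = w x * entry g (h x) z"
    using assms \<open>x \<in> X\<close> by simp
qed

lemma graph_comp:
  assumes "source g = Y" "\<forall>x\<in>X. h x \<in> Y"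
  shows "graph_mat X Y h \<odot> g = mat X (target g) (\<lambda>x z. entry g (h x) z)"
  using weighted_graph_comp[of g Y X h "\<lambda>x. 1", OF assms] by (simp add: graph_mat_def)

lemma ident_comp: "f \<in> RPi_hom X Y \<Longrightarrow> RPi_ident X \<odot> f = f"
  using graph_comp[of f X X "\<lambda>x. x"] by (simp add: RPi_ident_def graph_mat_def RPi_hom_iff_mat)

lemma comp_ident: "f \<in> RPi_hom X Y \<Longrightarrow> f \<odot> RPi_ident Y = f"
  using comp_cograph[of f Y Y "\<lambda>x. x"] by (simp add: ident_cograph RPi_hom_iff_mat)

section \<open>The additive symmetric monoidal structure\<close>

lemma category: "category UNIV RPi_hom RPi_ident (RPi_comp csum)"
proof
  fix f g h :: "('a, 'r) arrow" and A B C D :: "'a elem set"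
  show "(f \<odot> g) \<odot> h = f \<odot> (g \<odot> h)"
    if "f \<in> RPi_hom A B" "g \<in> RPi_hom B C" "h \<in> RPi_hom C D"
    using that by (intro comp_assoc) (simp_all add: RPi_hom_def)
qed (auto simp: ident_comp comp_ident, auto simp: RPi_hom_def RPi_ident_def RPi_comp_def entry_mat)

interpretation cat: category UNIV RPi_hom RPi_ident "RPi_comp csum"
  by (rule category)

lemma inverse_arrows_cograph:
  assumes "\<forall>x\<in>X. k x \<in> Y \<and> h (k x) = x" "\<forall>y\<in>Y. h y \<in> X \<and> k (h y) = y"
  shows "cat.inverse_arrows X Y (cograph X Y h) (cograph Y X k)"
  using assms
  by (auto simp: cat.inverse_arrows_def ident_cograph cograph_comp_cograph intro: cograph_eqI)

lemma inv_ar_eq: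
  assumes "cat.inverse_arrows X Y f g"
  shows "cat.inv_ar f = g"
  unfolding cat.inv_ar_def
proof (rule the_equality)
  show "\<exists>A B. cat.inverse_arrows A B f g" using assms by blast
next
  fix g' assume "\<exists>A B. cat.inverse_arrows A B f g'"
  then obtain A B where g': "cat.inverse_arrows A B f g'" by blast
  then have "A = X" "B = Y"
    using assms cat.hom_unique unfolding cat.inverse_arrows_def by blast+
  with g' assms have hom: "f \<in> RPi_hom X Y" "g \<in> RPi_hom Y X" "g' \<in> RPi_hom Y X"
    and inv: "f \<odot> g' = RPi_ident X" "g \<odot> f = RPi_ident Y"
    by (simp_all add: cat.inverse_arrows_def)
  have "g' = (g \<odot> f) \<odot> g'" using ident_comp[OF hom(3)] inv by simp
  also have "\<dots> = g \<odot> (f \<odot> g')" using hom by (intro comp_assoc) (simp_all add: RPi_hom_def)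
  also have "\<dots> = g" using comp_ident[OF hom(2)] inv by simp
  finally show "g' = g" .
qed

lemma inverse_arrows_assoc: "cat.inverse_arrows
    (RPi_tensor_ob (RPi_tensor_ob X Y) Z) (RPi_tensor_ob X (RPi_tensor_ob Y Z)) (RPi_assoc X Y Z)
    (cograph (RPi_tensor_ob X (RPi_tensor_ob Y Z)) (RPi_tensor_ob (RPi_tensor_ob X Y) Z)
       (\<lambda>u. Pair (pfst (pfst u)) (Pair (psnd (pfst u)) (psnd u))))"
  unfolding assoc_cograph by (rule inverse_arrows_cograph) simp_all

lemma inverse_arrows_lunit: "cat.inverse_arrows (RPi_tensor_ob RPi_unit X) X (RPi_lunit X)
    (cograph X (RPi_tensor_ob RPi_unit X) psnd)"
  unfolding lunit_cograph by (rule inverse_arrows_cograph) simp_all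

lemma inverse_arrows_runit: "cat.inverse_arrows (RPi_tensor_ob X RPi_unit) X (RPi_runit X)
    (cograph X (RPi_tensor_ob X RPi_unit) pfst)"
  unfolding runit_cograph by (rule inverse_arrows_cograph) simp_all

lemmas inv_assoc = inv_ar_eq[OF inverse_arrows_assoc]
lemmas inv_lunit = inv_ar_eq[OF inverse_arrows_lunit]

lemma tensor_in_hom:
  "f \<in> RPi_hom A B \<Longrightarrow> g \<in> RPi_hom C D \<Longrightarrow>
    f \<boxtimes> g \<in> RPi_hom (RPi_tensor_ob A C) (RPi_tensor_ob B D)"
  by (simp add: RPi_tensor_ar_def source_hom target_hom)

lemma assoc_natural:
  "((f \<boxtimes> g) \<boxtimes> h) \<odot> RPi_assoc (target f) (target g) (target h) =
    RPi_assoc (source f) (source g) (source h) \<odot> (f \<boxtimes> (g \<boxtimes> h))"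
proof -
  have "((f \<boxtimes> g) \<boxtimes> h) \<odot> RPi_assoc (target f) (target g) (target h) =
     mat (RPi_tensor_ob (RPi_tensor_ob (source f) (source g)) (source h))
       (RPi_tensor_ob (target f) (RPi_tensor_ob (target g) (target h)))
       (\<lambda>x z. entry ((f \<boxtimes> g) \<boxtimes> h) x (Pair (Pair (pfst z) (pfst (psnd z))) (psnd (psnd z))))"
    unfolding assoc_cograph by (subst comp_cograph) simp_all
  also have "\<dots> = RPi_assoc (source f) (source g) (source h) \<odot> (f \<boxtimes> (g \<boxtimes> h))"
    unfolding RPi_assoc_def
    by (subst graph_comp; (rule mat_eqI)?) (simp_all add: entry_tensor mult.assoc)
  finally show ?thesis .
qed

lemma sym_natural:
  "(f \<boxtimes> g) \<odot> RPi_sym (target f) (target g) = RPi_sym (source f) (source g) \<odot> (g \<boxtimes> f)"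
proof -
  have "(f \<boxtimes> g) \<odot> RPi_sym (target f) (target g) =
     mat (RPi_tensor_ob (source f) (source g)) (RPi_tensor_ob (target g) (target f))
       (\<lambda>x z. entry (f \<boxtimes> g) x (Pair (psnd z) (pfst z)))"
    unfolding sym_cograph by (subst comp_cograph) simp_all
  also have "\<dots> = RPi_sym (source f) (source g) \<odot> (g \<boxtimes> f)"
    unfolding RPi_sym_def
    by (subst graph_comp; (rule mat_eqI)?) (simp_all add: entry_tensor mult.commute)
  finally show ?thesis .
qed

lemma lunit_natural:
  "(RPi_ident RPi_unit \<boxtimes> f) \<odot> RPi_lunit (target f) = RPi_lunit (source f) \<odot> f"
proof -
  have "(RPi_ident RPi_unit \<boxtimes> f) \<odot> RPi_lunit (target f) =
     mat (RPi_tensor_ob RPi_unit (source f)) (target f)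
       (\<lambda>x z. entry (RPi_ident RPi_unit \<boxtimes> f) x (Pair Star z))"
    unfolding lunit_cograph by (subst comp_cograph) (simp_all add: RPi_ident_def)
  also have "\<dots> = RPi_lunit (source f) \<odot> f"
    unfolding RPi_lunit_def
    by (subst graph_comp; (rule mat_eqI)?) (simp_all add: entry_tensor RPi_ident_def)
  finally show ?thesis .
qed

lemma runit_natural:
  "(f \<boxtimes> RPi_ident RPi_unit) \<odot> RPi_runit (target f) = RPi_runit (source f) \<odot> f"
proof -
  have "(f \<boxtimes> RPi_ident RPi_unit) \<odot> RPi_runit (target f) =
     mat (RPi_tensor_ob (source f) RPi_unit) (target f)
       (\<lambda>x z. entry (f \<boxtimes> RPi_ident RPi_unit) x (Pair z Star))"
    unfolding runit_cograph by (subst comp_cograph) (simp_all add: RPi_ident_def)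
  also have "\<dots> = RPi_runit (source f) \<odot> f"
    unfolding RPi_runit_def
    by (subst graph_comp; (rule mat_eqI)?) (simp_all add: entry_tensor RPi_ident_def)
  finally show ?thesis .
qed

lemma symmetric_monoidal_category:
  "symmetric_monoidal_category UNIV RPi_hom RPi_ident (RPi_comp csum)
    RPi_tensor_ob RPi_tensor_ar RPi_unit RPi_assoc RPi_lunit RPi_runit RPi_sym"
proof
  fix f g h k :: "('a, 'r) arrow" and A B C A' B' C' :: "'a elem set"
  show "(f \<odot> g) \<boxtimes> (h \<odot> k) = (f \<boxtimes> h) \<odot> (g \<boxtimes> k)"
    if "f \<in> RPi_hom A B" "g \<in> RPi_hom B C" "h \<in> RPi_hom A' B'" "k \<in> RPi_hom B' C'"
    using that by (intro tensor_comp) (simp_all add: RPi_hom_def)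
  show "((f \<boxtimes> g) \<boxtimes> h) \<odot> RPi_assoc A' B' C' = RPi_assoc A B C \<odot> (f \<boxtimes> (g \<boxtimes> h))"
    if "f \<in> RPi_hom A A'" "g \<in> RPi_hom B B'" "h \<in> RPi_hom C C'"
    using that assoc_natural[of f g h] by (simp add: source_hom target_hom)
  show "(f \<boxtimes> g) \<odot> RPi_sym A' B' = RPi_sym A B \<odot> (g \<boxtimes> f)"
    if "f \<in> RPi_hom A A'" "g \<in> RPi_hom B B'"
    using that sym_natural[of f g] by (simp add: source_hom target_hom)
  show "(RPi_ident RPi_unit \<boxtimes> f) \<odot> RPi_lunit B = RPi_lunit A \<odot> f" if "f \<in> RPi_hom A B"
    using that lunit_natural[of f] by (simp add: source_hom target_hom)
  show "(f \<boxtimes> RPi_ident RPi_unit) \<odot> RPi_runit B = RPi_runit A \<odot> f" if "f \<in> RPi_hom A B"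
    using that runit_natural[of f] by (simp add: source_hom target_hom)
  show "cat.iso (RPi_tensor_ob (RPi_tensor_ob A B) C) (RPi_tensor_ob A (RPi_tensor_ob B C))
      (RPi_assoc A B C)"
    using inverse_arrows_assoc by (auto simp: cat.iso_def)
  show "cat.iso (RPi_tensor_ob RPi_unit A) A (RPi_lunit A)"
    using inverse_arrows_lunit by (auto simp: cat.iso_def)
  show "cat.iso (RPi_tensor_ob A RPi_unit) A (RPi_runit A)"
    using inverse_arrows_runit by (auto simp: cat.iso_def)
  (* What remains are equations between composites of structural maps, hence between cographs. *)
qed (simp_all add: tensor_in_hom structure_cograph cograph_tensor cograph_comp_cograph,
  (rule cograph_eqI; simp)+)

lemma comp_plus:
  "target f = source g \<Longrightarrow> target g = target h \<Longrightarrow>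
    f \<odot> RPi_plus g h = RPi_plus (f \<odot> g) (f \<odot> h)"
  by (auto simp: RPi_comp_def RPi_plus_def csum_add[symmetric] distrib_left intro!: mat_eqI csum_cong)

lemma plus_comp:
  "source f = source g \<Longrightarrow> target f = target g \<Longrightarrow>
    RPi_plus f g \<odot> h = RPi_plus (f \<odot> h) (g \<odot> h)"
  by (auto simp: RPi_comp_def RPi_plus_def csum_add[symmetric] distrib_right intro!: mat_eqI csum_cong)

end

lemma source_structure [simp]:
  "source (RPi_ident X) = X"
  "source (RPi_assoc X Y Z) = RPi_tensor_ob (RPi_tensor_ob X Y) Z"
  "source (RPi_lunit X) = RPi_tensor_ob RPi_unit X"
  "source (RPi_sym X Y) = RPi_tensor_ob X Y"
  "source (RPi_counit X) = RPi_bang_ob X"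
  "source (RPi_comult X) = RPi_bang_ob X"
  "source (RPi_copy X) = RPi_bang_ob X"
  "source (RPi_discard X) = RPi_bang_ob X"
  "source (RPi_mon X Y) = RPi_tensor_ob (RPi_bang_ob X) (RPi_bang_ob Y)"
  "source (RPi_deriv X) = RPi_tensor_ob (RPi_bang_ob X) X"
  by (simp_all add: RPi_ident_def RPi_assoc_def graph_mat_def RPi_lunit_def RPi_sym_def
      RPi_counit_def RPi_comult_def RPi_copy_def RPi_discard_def RPi_mon_def RPi_deriv_def)

lemma target_structure [simp]:
  "target (RPi_ident X) = X"
  "target (RPi_assoc X Y Z) = RPi_tensor_ob X (RPi_tensor_ob Y Z)"
  "target (RPi_lunit X) = X"
  "target (RPi_sym X Y) = RPi_tensor_ob Y X"
  "target (RPi_counit X) = X"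
  "target (RPi_comult X) = RPi_bang_ob (RPi_bang_ob X)"
  "target (RPi_copy X) = RPi_tensor_ob (RPi_bang_ob X) (RPi_bang_ob X)"
  "target (RPi_discard X) = RPi_unit"
  "target (RPi_mon X Y) = RPi_bang_ob (RPi_tensor_ob X Y)"
  "target (RPi_deriv X) = RPi_bang_ob X"
  by (simp_all add: RPi_ident_def RPi_assoc_def graph_mat_def RPi_lunit_def RPi_sym_def
      RPi_counit_def RPi_comult_def RPi_copy_def RPi_discard_def RPi_mon_def RPi_deriv_def)

context elem_complete_semiring
begin

lemma tensor_plus:
  "source g = source h \<Longrightarrow> target g = target h \<Longrightarrow>
    f \<boxtimes> RPi_plus g h = RPi_plus (f \<boxtimes> g) (f \<boxtimes> h)"
  unfolding RPi_tensor_ar_def RPi_plus_def by (rule mat_eqI) (simp_all add: distrib_left)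

lemma plus_tensor:
  "source f = source g \<Longrightarrow> target f = target g \<Longrightarrow>
    RPi_plus f g \<boxtimes> h = RPi_plus (f \<boxtimes> h) (g \<boxtimes> h)"
  unfolding RPi_tensor_ar_def RPi_plus_def by (rule mat_eqI) (simp_all add: distrib_right)

lemma additive_symmetric_monoidal_category:
  "additive_symmetric_monoidal_category UNIV RPi_hom RPi_ident (RPi_comp csum)
    RPi_tensor_ob RPi_tensor_ar RPi_unit RPi_assoc RPi_lunit RPi_runit RPi_sym RPi_plus RPi_zero"
proof (intro additive_symmetric_monoidal_category.intro symmetric_monoidal_category
    additive_symmetric_monoidal_category_axioms.intro)
  fix f g h :: "('a, 'r) arrow" and A B C D :: "'a elem set"
  show "RPi_plus f g \<in> RPi_hom A B" if "f \<in> RPi_hom A B" "g \<in> RPi_hom A B"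
    using that by (simp add: RPi_plus_def source_hom target_hom)
  show "RPi_plus (RPi_plus f g) h = RPi_plus f (RPi_plus g h)"
    if "f \<in> RPi_hom A B" "g \<in> RPi_hom A B" "h \<in> RPi_hom A B"
    unfolding RPi_plus_def
    using that by (intro mat_eqI) (simp_all add: source_hom target_hom add.assoc)
  show "RPi_plus f g = RPi_plus g f" if "f \<in> RPi_hom A B" "g \<in> RPi_hom A B"
    unfolding RPi_plus_def
    using that by (intro mat_eqI) (simp_all add: source_hom target_hom add.commute)
  show "RPi_plus (RPi_zero A B) f = f" if "f \<in> RPi_hom A B"
    using that
    by (intro arrow_eqI[of _ A B]) (simp_all add: RPi_plus_def RPi_zero_def source_hom target_hom)
  show "f \<odot> RPi_plus g h = RPi_plus (f \<odot> g) (f \<odot> h)"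
    if "f \<in> RPi_hom A B" "g \<in> RPi_hom B C" "h \<in> RPi_hom B C"
    using that by (intro comp_plus) (simp_all add: source_hom target_hom)
  show "RPi_plus f g \<odot> h = RPi_plus (f \<odot> h) (g \<odot> h)"
    if "f \<in> RPi_hom A B" "g \<in> RPi_hom A B" "h \<in> RPi_hom B C"
    using that by (intro plus_comp) (simp_all add: source_hom target_hom)
  show "f \<odot> RPi_zero B C = RPi_zero A C" if "f \<in> RPi_hom A B"
    unfolding RPi_comp_def RPi_zero_def using that
    by (intro mat_eqI) (auto simp: source_hom target_hom intro!: csum_eq_zero)
  show "RPi_zero A B \<odot> f = RPi_zero A C" if "f \<in> RPi_hom B C"
    unfolding RPi_comp_def RPi_zero_def using that
    by (intro mat_eqI) (auto simp: source_hom target_hom intro!: csum_eq_zero)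
  show "f \<boxtimes> RPi_plus g h = RPi_plus (f \<boxtimes> g) (f \<boxtimes> h)"
    if "f \<in> RPi_hom A B" "g \<in> RPi_hom C D" "h \<in> RPi_hom C D"
    using that by (intro tensor_plus) (simp_all add: source_hom target_hom)
  show "RPi_plus f g \<boxtimes> h = RPi_plus (f \<boxtimes> h) (g \<boxtimes> h)"
    if "f \<in> RPi_hom A B" "g \<in> RPi_hom A B" "h \<in> RPi_hom C D"
    using that by (intro plus_tensor) (simp_all add: source_hom target_hom)
  show "f \<boxtimes> RPi_zero C D = RPi_zero (RPi_tensor_ob A C) (RPi_tensor_ob B D)"
    if "f \<in> RPi_hom A B"
    unfolding RPi_tensor_ar_def RPi_zero_def using that
    by (intro mat_eqI) (simp_all add: source_hom target_hom)
  show "RPi_zero A B \<boxtimes> f = RPi_zero (RPi_tensor_ob A C) (RPi_tensor_ob B D)"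
    if "f \<in> RPi_hom C D"
    unfolding RPi_tensor_ar_def RPi_zero_def using that
    by (intro mat_eqI) (simp_all add: source_hom target_hom)
qed (simp add: RPi_zero_def)

end

section \<open>The exponential of a matrix\<close>

text \<open>Regard a function on bags as a formal power series in commuting variables. Then \<open>pick f y\<close> is the
  multiplication by the linear form \<open>\<Sum>x. f x y * x\<close>, and the column of \<open>!f\<close> at \<open>q\<close> is the product
  of the linear forms of the elements of \<open>q\<close>. In particular, the order of the factors
  does not matter.\<close>

definition pick :: "('e \<Rightarrow> 'e \<Rightarrow> 'r::semiring_0) \<Rightarrow> 'e \<Rightarrow> ('e multiset \<Rightarrow> 'r) \<Rightarrow> 'e multiset \<Rightarrow> 'r" where
  "pick f y \<phi> p = (\<Sum>x\<in>set_mset p. f x y * \<phi> (p - {#x#}))"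

lemma pick_commute:
  fixes f :: "'e \<Rightarrow> 'e \<Rightarrow> 'r::comm_semiring_0"
  shows "pick f y (pick f z \<phi>) = pick f z (pick f y \<phi>)"
proof
  fix p :: "'e multiset"
  define R where "R = (\<lambda>x x'. x' \<in># p - {#x#})"
  have R: "set_mset (p - {#x#}) = {x'. x' \<in> set_mset p \<and> R x x'}" for x
    by (auto simp: R_def dest: in_diffD)
  have R_sym: "R x x' \<longleftrightarrow> R x' x" if "x \<in># p" "x' \<in># p" for x x'
    using that by (auto simp: R_def in_diff_count)
  have "pick f y (pick f z \<phi>) p = (\<Sum>x\<in>set_mset p. \<Sum>x' | x' \<in> set_mset p \<and> R x x'.
      f x y * (f x' z * \<phi> (p - {#x#} - {#x'#})))"
    by (simp only: pick_def R sum_distrib_left)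
  also have "\<dots> = (\<Sum>x'\<in>set_mset p. \<Sum>x | x \<in> set_mset p \<and> R x x'.
      f x y * (f x' z * \<phi> (p - {#x#} - {#x'#})))"
    by (rule sum.swap_restrict) simp_all
  also have "\<dots> = (\<Sum>x'\<in>set_mset p. \<Sum>x | x \<in> set_mset p \<and> R x' x.
      f x' z * (f x y * \<phi> (p - {#x'#} - {#x#})))"
    by (intro sum.cong refl) (auto simp: R_sym mult.left_commute add_mset_commute)
  also have "\<dots> = pick f z (pick f y \<phi>) p"
    by (simp only: pick_def R sum_distrib_left)
  finally show "pick f y (pick f z \<phi>) p = pick f z (pick f y \<phi>) p" .
qed

definition power_column ::
  "('e \<Rightarrow> 'e \<Rightarrow> 'r::{comm_semiring_0, one}) \<Rightarrow> 'e multiset \<Rightarrow> 'e multiset \<Rightarrow> 'r" where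
  "power_column f q = fold_mset (pick f) (\<lambda>p. \<delta> p {#}) q"

lemma power_column_empty [simp]: "power_column f {#} p = \<delta> p {#}"
  by (simp add: power_column_def)

lemma power_column_add_mset:
  "power_column f (add_mset y q) p = (\<Sum>x\<in>set_mset p. f x y * power_column f q (p - {#x#}))"
proof -
  interpret comp_fun_commute "pick f"
    by standard (simp add: fun_eq_iff pick_commute)
  show ?thesis by (simp add: power_column_def pick_def)
qed

text \<open>The head of the tuple \<open>xs\<close> is the element of \<open>p\<close> that the factor of the head of \<open>ys\<close> removes.
  As the right-hand side depends on \<open>ys\<close> only through the bag, so does the sum over tuples.\<close>

lemma sum_lists_eq_power_column:
  fixes f :: "'e \<Rightarrow> 'e \<Rightarrow> 'r::{comm_semiring_0, comm_monoid_mult}"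
  shows "(\<Sum>xs | length xs = length ys \<and> mset xs = p. \<Prod>i<length ys. f (xs ! i) (ys ! i)) =
    power_column f (mset ys) p"
proof (induction ys arbitrary: p)
  case Nil
  have "{xs. xs = [] \<and> mset xs = p} = (if p = {#} then {[]} else {})" by auto
  then show ?case by (simp add: \<delta>_def)
next
  case (Cons y ys)
  let ?L = "\<lambda>p :: 'e multiset. {xs. length xs = length ys \<and> mset xs = p}"
  let ?P = "\<lambda>xs. \<Prod>i<length ys. f (xs ! i) (ys ! i)"
  have fin: "finite (?L p)" for p
    by (rule finite_subset[OF _ finite_lists_length_eq[of "set_mset p" "length ys"]]) auto
  have "(\<Sum>xs | length xs = length (y # ys) \<and> mset xs = p.
      \<Prod>i<length (y # ys). f (xs ! i) ((y # ys) ! i)) =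
    (\<Sum>(x, xs)\<in>Sigma (set_mset p) (\<lambda>x. ?L (p - {#x#})). f x y * ?P xs)"
  proof (rule sum.reindex_bij_witness[where i = "\<lambda>(x, xs). x # xs" and j = "\<lambda>xs. (hd xs, tl xs)"])
    fix xs assume "xs \<in> {xs. length xs = length (y # ys) \<and> mset xs = p}"
    then obtain x xs' where xs: "xs = x # xs'" "length xs' = length ys" "p = add_mset x (mset xs')"
      by (cases xs) auto
    then show "(case (hd xs, tl xs) of (x, xs) \<Rightarrow> x # xs) = xs"
      "(hd xs, tl xs) \<in> Sigma (set_mset p) (\<lambda>x. ?L (p - {#x#}))" by simp_all
    show "(case (hd xs, tl xs) of (x, xs) \<Rightarrow> f x y * ?P xs) =
        (\<Prod>i<length (y # ys). f (xs ! i) ((y # ys) ! i))"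
      using xs by (simp add: prod.lessThan_Suc_shift del: prod.lessThan_Suc)
  qed auto
  also have "\<dots> = (\<Sum>x\<in>set_mset p. \<Sum>xs\<in>?L (p - {#x#}). f x y * ?P xs)"
    using fin by (subst sum.Sigma) simp_all
  also have "\<dots> = power_column f (mset (y # ys)) p"
    by (simp add: power_column_add_mset Cons.IH flip: sum_distrib_left)
  finally show ?case .
qed

lemma entry_bang:
  assumes "set_mset M \<subseteq> source f" "set_mset N \<subseteq> target f"
  shows "entry (RPi_bang_ar f) (Bag M) (Bag N) = power_column (entry f) N M"
proof -
  define ys where "ys = (SOME ys. mset ys = N)"
  have "mset ys = N"
    unfolding ys_def by (rule someI_ex) (rule ex_mset)
  then show ?thesis
    using assms by (simp add: RPi_bang_ar_def sum_lists_eq_power_column flip: ys_def)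
qed

lemma bang_in_hom: "f \<in> RPi_hom X Y \<Longrightarrow> RPi_bang_ar f \<in> RPi_hom (RPi_bang_ob X) (RPi_bang_ob Y)"
  by (simp add: RPi_bang_ar_def source_hom target_hom)

text \<open>This is \<open>\<Delta>\<close> followed by \<open>\<epsilon>\<close> on the first factor, that is, the map \<open>\<d>\<degree>\<close> up to the symmetry.\<close>

definition uncons :: "'a elem set \<Rightarrow> ('a, 'r::{zero, one}) arrow" where
  "uncons X = cograph (RPi_bang_ob X) (RPi_tensor_ob X (RPi_bang_ob X))
     (\<lambda>u. Bag (add_mset (pfst u) (bag (psnd u))))"

lemma source_uncons [simp]: "source (uncons X) = RPi_bang_ob X"
  and target_uncons [simp]: "target (uncons X) = RPi_tensor_ob X (RPi_bang_ob X)"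
  by (simp_all add: uncons_def)

context elem_complete_semiring
begin

text \<open>The next two lemmas are the only facts about the entries of \<open>!f\<close> that the equality criteria
  of the next section need.\<close>

lemma bang_discard:
  "RPi_bang_ar f \<odot> RPi_discard (target f) = RPi_discard (source f)"
  unfolding discard_cograph
  by (subst comp_cograph; (unfold cograph_def)?; (rule mat_eqI)?) (simp_all add: entry_bang \<delta>_def)

lemma bang_uncons:
  "RPi_bang_ar f \<odot> uncons (target f) = uncons (source f) \<odot> (f \<boxtimes> RPi_bang_ar f)"
proof (intro arrow_eqI)
  show "RPi_bang_ar f \<odot> uncons (target f) \<in>
      RPi_hom (RPi_bang_ob (source f)) (RPi_tensor_ob (target f) (RPi_bang_ob (target f)))"
    "uncons (source f) \<odot> (f \<boxtimes> RPi_bang_ar f) \<in>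
      RPi_hom (RPi_bang_ob (source f)) (RPi_tensor_ob (target f) (RPi_bang_ob (target f)))"
    by (simp_all add: RPi_comp_def)
  have "entry (RPi_bang_ar f \<odot> uncons (target f)) (Bag M) (Pair y (Bag N)) =
      entry (uncons (source f) \<odot> (f \<boxtimes> RPi_bang_ar f)) (Bag M) (Pair y (Bag N))"
    if M: "set_mset M \<subseteq> source f" and y: "y \<in> target f" and N: "set_mset N \<subseteq> target f" for M N y
  proof -
    let ?X = "RPi_tensor_ob (source f) (RPi_bang_ob (source f))"
    let ?r = "\<lambda>u. entry (uncons (source f)) (Bag M) u *
      entry (f \<boxtimes> RPi_bang_ar f) u (Pair y (Bag N))"
    let ?h = "\<lambda>x. Pair x (Bag (M - {#x#}))"
    have sub: "set_mset (M - {#x#}) \<subseteq> source f" for x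
      using M by (auto dest: in_diffD)
    (* Only the finitely many ways to take an element out of M contribute to the sum. *)
    have zero: "?r u = 0" if u: "u \<in> ?X" "u \<notin> ?h ` set_mset M" for u
    proof -
      obtain x K where xK: "u = Pair x (Bag K)" "x \<in> source f" "set_mset K \<subseteq> source f"
        using u by (auto simp: RPi_tensor_ob_def RPi_bang_ob_def)
      then have "M \<noteq> add_mset x K" using u by auto
      then show ?thesis using M xK by (simp add: uncons_def cograph_def)
    qed
    have "entry (uncons (source f) \<odot> (f \<boxtimes> RPi_bang_ar f)) (Bag M) (Pair y (Bag N)) = csum ?r ?X"
      using M y N by (simp add: entry_comp)
    also have "\<dots> = csum ?r (?h ` set_mset M)"
      using zero M sub by (intro csum_mono_neutral) auto
    also have "\<dots> = (\<Sum>x\<in>set_mset M. ?r (?h x))"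
      by (subst csum_finite) (simp_all add: sum.reindex inj_on_def)
    also have "\<dots> = (\<Sum>x\<in>set_mset M. entry f x y * power_column (entry f) N (M - {#x#}))"
    proof (intro sum.cong refl)
      fix x assume x: "x \<in> set_mset M"
      then have "x \<in> source f" using M by auto
      then show "?r (?h x) = entry f x y * power_column (entry f) N (M - {#x#})"
        using x M y N sub by (simp add: uncons_def cograph_def entry_tensor entry_bang)
    qed
    also have "\<dots> = entry (RPi_bang_ar f \<odot> uncons (target f)) (Bag M) (Pair y (Bag N))"
      unfolding uncons_def using M y N
      by (subst comp_cograph) (simp_all add: entry_bang power_column_add_mset)
    finally show ?thesis ..
  qed
  then show "\<forall>x\<in>RPi_bang_ob (source f). \<forall>y\<in>RPi_tensor_ob (target f) (RPi_bang_ob (target f)).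
    entry (RPi_bang_ar f \<odot> uncons (target f)) x y =
    entry (uncons (source f) \<odot> (f \<boxtimes> RPi_bang_ar f)) x y"
    by simp
qed

section \<open>Equality of arrows into an exponential\<close>

text \<open>Columns of \<open>B \<cdot> (g \<otimes> M)\<close> are computed from single columns of \<open>M\<close>, so in the criteria below
  a recursion \<open>M \<cdot> uncons = B \<cdot> (g \<otimes> M)\<close> gives the column at \<open>y + q\<close> from the one at \<open>q\<close>.\<close>

lemma entry_comp_tensor_cong:
  assumes "target B = RPi_tensor_ob (source g) W" "M \<in> RPi_hom W Z" "N \<in> RPi_hom W Z"
    and "\<forall>w\<in>W. entry M w z = entry N w z"
    and "x \<in> source B" "y \<in> target g" "z \<in> Z"
  shows "entry (B \<odot> (g \<boxtimes> M)) x (Pair y z) = entry (B \<odot> (g \<boxtimes> N)) x (Pair y z)"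
proof -
  have "\<forall>u\<in>target B. entry (g \<boxtimes> M) u (Pair y z) = entry (g \<boxtimes> N) u (Pair y z)"
    using assms by (simp add: entry_tensor source_hom target_hom)
  then show ?thesis
    using assms(2,3,5-7) by (auto simp: entry_comp source_hom target_hom intro!: csum_cong)
qed

lemma arrow_to_bang_eqI:
  assumes hom: "M \<in> RPi_hom W (RPi_bang_ob Y)" "N \<in> RPi_hom W (RPi_bang_ob Y)"
    and discard: "M \<odot> RPi_discard Y = N \<odot> RPi_discard Y"
    and uncons: "M \<odot> uncons Y = T M" "N \<odot> uncons Y = T N"
    and T: "\<And>w y K. w \<in> W \<Longrightarrow> y \<in> Y \<Longrightarrow> set_mset K \<subseteq> Y \<Longrightarrow>
      \<forall>w\<in>W. entry M w (Bag K) = entry N w (Bag K) \<Longrightarrow>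
      entry (T M) w (Pair y (Bag K)) = entry (T N) w (Pair y (Bag K))"
  shows "M = N"
proof -
  have entry_discard: "entry L w (Bag {#}) = entry (L \<odot> RPi_discard Y) w Star"
    if "L \<in> RPi_hom W (RPi_bang_ob Y)" "w \<in> W" for L w
    unfolding discard_cograph
    using that by (subst comp_cograph) (simp_all add: source_hom target_hom)
  have entry_uncons: "entry L w (Bag (add_mset y K)) = entry (L \<odot> uncons Y) w (Pair y (Bag K))"
    if "L \<in> RPi_hom W (RPi_bang_ob Y)" "w \<in> W" "y \<in> Y" "set_mset K \<subseteq> Y" for L w y K
    unfolding uncons_def
    using that by (subst comp_cograph) (simp_all add: source_hom target_hom)
  have "set_mset K \<subseteq> Y \<Longrightarrow> \<forall>w\<in>W. entry M w (Bag K) = entry N w (Bag K)" for K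
  proof (induction K)
    case empty
    then show ?case using hom discard by (simp add: entry_discard)
  next
    case (add y K)
    then show ?case using hom by (simp add: entry_uncons uncons T)
  qed
  then show ?thesis
    using hom by (intro arrow_eqI[of M W "RPi_bang_ob Y" N]) simp_all
qed

text \<open>The recursion for functoriality of \<open>!\<close> and naturality of \<open>\<rho>\<close> and \<open>\<m>\<close>.\<close>

lemma arrow_to_bang_eqI_tensor:
  assumes hom: "M \<in> RPi_hom W (RPi_bang_ob (target g))" "N \<in> RPi_hom W (RPi_bang_ob (target g))"
    and B: "source B = W" "target B = RPi_tensor_ob (source g) W"
    and "M \<odot> RPi_discard (target g) = N \<odot> RPi_discard (target g)"
    and "M \<odot> uncons (target g) = B \<odot> (g \<boxtimes> M)" "N \<odot> uncons (target g) = B \<odot> (g \<boxtimes> N)"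
  shows "M = N"
  using hom(1,2) assms(5-7)
proof (rule arrow_to_bang_eqI)
  fix w y K assume "w \<in> W" "y \<in> target g" "set_mset K \<subseteq> target g"
    "\<forall>w\<in>W. entry M w (Bag K) = entry N w (Bag K)"
  then show "entry (B \<odot> (g \<boxtimes> M)) w (Pair y (Bag K)) = entry (B \<odot> (g \<boxtimes> N)) w (Pair y (Bag K))"
    using B hom
    by (intro entry_comp_tensor_cong[where W = W and Z = "RPi_bang_ob (target g)"]) simp_all
qed

text \<open>The recursion for naturality of \<open>\<d>\<close>, where the Leibniz rule produces a second summand.\<close>

lemma arrow_to_bang_eqI_plus:
  assumes hom: "M \<in> RPi_hom W (RPi_bang_ob (target g))" "N \<in> RPi_hom W (RPi_bang_ob (target g))"
    and B: "source B = W" "target B = RPi_tensor_ob (source g) W"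
    and S: "source S = W" "target S = RPi_tensor_ob (target g) (RPi_bang_ob (target g))"
    and "M \<odot> RPi_discard (target g) = N \<odot> RPi_discard (target g)"
    and "M \<odot> uncons (target g) = RPi_plus S (B \<odot> (g \<boxtimes> M))"
      "N \<odot> uncons (target g) = RPi_plus S (B \<odot> (g \<boxtimes> N))"
  shows "M = N"
  using hom(1,2) assms(7-9)
proof (rule arrow_to_bang_eqI)
  fix w y K assume *: "w \<in> W" "y \<in> target g" "set_mset K \<subseteq> target g"
    "\<forall>w\<in>W. entry M w (Bag K) = entry N w (Bag K)"
  have "entry (B \<odot> (g \<boxtimes> M)) w (Pair y (Bag K)) = entry (B \<odot> (g \<boxtimes> N)) w (Pair y (Bag K))"
    using B hom *
    by (intro entry_comp_tensor_cong[where W = W and Z = "RPi_bang_ob (target g)"]) simp_all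
  then show "entry (RPi_plus S (B \<odot> (g \<boxtimes> M))) w (Pair y (Bag K)) =
      entry (RPi_plus S (B \<odot> (g \<boxtimes> N))) w (Pair y (Bag K))"
    using S * by (simp add: RPi_plus_def)
qed

text \<open>The variant with a parameter \<open>Z\<close>, for naturality of \<open>\<Delta>\<close>: columns are indexed by pairs, and the
  induction runs over the bag in the first component.\<close>

lemma arrow_to_bang_tensor_eqI:
  assumes hom: "M \<in> RPi_hom W (RPi_tensor_ob (RPi_bang_ob (target g)) Z)"
      "N \<in> RPi_hom W (RPi_tensor_ob (RPi_bang_ob (target g)) Z)"
    and B: "source B = W" "target B = RPi_tensor_ob (source g) W"
    and discard: "M \<odot> ((RPi_discard (target g) \<boxtimes> RPi_ident Z) \<odot> RPi_lunit Z) =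
      N \<odot> ((RPi_discard (target g) \<boxtimes> RPi_ident Z) \<odot> RPi_lunit Z)"
    and uncons:
      "M \<odot> ((uncons (target g) \<boxtimes> RPi_ident Z) \<odot> RPi_assoc (target g) (RPi_bang_ob (target g)) Z) =
        B \<odot> (g \<boxtimes> M)"
      "N \<odot> ((uncons (target g) \<boxtimes> RPi_ident Z) \<odot> RPi_assoc (target g) (RPi_bang_ob (target g)) Z) =
        B \<odot> (g \<boxtimes> N)"
  shows "M = N"
proof -
  let ?Y = "target g"
  let ?V = "RPi_tensor_ob (RPi_bang_ob ?Y) Z"
  let ?d = "(RPi_discard ?Y \<boxtimes> RPi_ident Z) \<odot> RPi_lunit Z"
  let ?u = "(uncons ?Y \<boxtimes> RPi_ident Z) \<odot> RPi_assoc ?Y (RPi_bang_ob ?Y) Z"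
  have d: "?d = cograph ?V Z (Pair (Bag {#}))"
    by (simp add: structure_cograph cograph_tensor cograph_comp_cograph)
  have u: "?u = cograph ?V (RPi_tensor_ob ?Y ?V)
      (\<lambda>v. Pair (Bag (add_mset (pfst v) (bag (pfst (psnd v))))) (psnd (psnd v)))"
    by (simp add: uncons_def structure_cograph cograph_tensor cograph_comp_cograph)
  have entry_d: "entry L w (Pair (Bag {#}) z) = entry (L \<odot> ?d) w z"
    if "L \<in> RPi_hom W ?V" "w \<in> W" "z \<in> Z" for L w z
    unfolding d using that by (subst comp_cograph) (simp_all add: source_hom target_hom)
  have entry_u: "entry L w (Pair (Bag (add_mset y K)) z) = entry (L \<odot> ?u) w (Pair y (Pair (Bag K) z))"
    if "L \<in> RPi_hom W ?V" "w \<in> W" "y \<in> ?Y" "set_mset K \<subseteq> ?Y" "z \<in> Z" for L w y K z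
    unfolding u using that by (subst comp_cograph) (simp_all add: source_hom target_hom)
  have "set_mset K \<subseteq> ?Y \<Longrightarrow>
    \<forall>w\<in>W. \<forall>z\<in>Z. entry M w (Pair (Bag K) z) = entry N w (Pair (Bag K) z)" for K
  proof (induction K)
    case empty
    then show ?case using hom discard by (simp add: entry_d)
  next
    case (add y K)
    then have "entry (B \<odot> (g \<boxtimes> M)) w (Pair y (Pair (Bag K) z)) =
        entry (B \<odot> (g \<boxtimes> N)) w (Pair y (Pair (Bag K) z))" if "w \<in> W" "z \<in> Z" for w z
      using B hom that
      by (intro entry_comp_tensor_cong[where W = W and Z = ?V]) simp_all
    then show ?case using add.prems hom by (simp add: entry_u uncons)
  qed
  then show ?thesis
    using hom by (intro arrow_eqI[of M W ?V N]) simp_all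
qed

section \<open>The monoidal coalgebra modality\<close>

text \<open>The cograph of the image map satisfies the recursion of \<open>!\<close> because taking images commutes
  with the insertion of an element.\<close>

lemma bang_cograph:
  assumes h: "\<forall>y\<in>Y. h y \<in> X"
  shows "RPi_bang_ar (cograph X Y h) =
    (cograph (RPi_bang_ob X) (RPi_bang_ob Y) (\<lambda>q. Bag (image_mset h (bag q))) :: ('a, 'r) arrow)"
    (is "?M = ?N")
proof -
  let ?g = "cograph X Y h :: ('a, 'r) arrow"
  have img: "image_mset h K \<in> {K. set_mset K \<subseteq> X}" if "set_mset K \<subseteq> Y" for K
    using h that by auto
  show ?thesis
  proof (rule arrow_to_bang_eqI_tensor[of _ "RPi_bang_ob X" ?g _ "uncons X"])
    show "?M \<odot> RPi_discard (target ?g) = ?N \<odot> RPi_discard (target ?g)"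
      using bang_discard[of ?g]
      by (simp add: discard_cograph cograph_comp_cograph)
    show "?M \<odot> uncons (target ?g) = uncons X \<odot> (?g \<boxtimes> ?M)"
      using bang_uncons[of ?g] by simp
    show "?N \<odot> uncons (target ?g) = uncons X \<odot> (?g \<boxtimes> ?N)"
      using h img by (simp add: uncons_def cograph_tensor cograph_comp_cograph cograph_eqI)
  qed (simp_all add: bang_in_hom)
qed

text \<open>The product \<open>!f \<cdot> !g\<close> satisfies the recursion that characterizes \<open>!(f \<cdot> g)\<close>: push \<open>uncons\<close>
  first through \<open>!g\<close> and then through \<open>!f\<close>.\<close>

lemma bang_comp:
  assumes "target f = source g"
  shows "RPi_bang_ar (f \<odot> g) = RPi_bang_ar f \<odot> RPi_bang_ar g" (is "?M = ?N")
proof (rule arrow_to_bang_eqI_tensor[of _ "RPi_bang_ob (source f)" "f \<odot> g" _ "uncons (source f)"])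
  show "?M \<odot> RPi_discard (target (f \<odot> g)) = ?N \<odot> RPi_discard (target (f \<odot> g))"
    using bang_discard[of f] bang_discard[of g] bang_discard[of "f \<odot> g"] assms
    by (simp add: comp_assoc)
  show "?M \<odot> uncons (target (f \<odot> g)) = uncons (source f) \<odot> ((f \<odot> g) \<boxtimes> ?M)"
    using bang_uncons[of "f \<odot> g"] by simp
  have "?N \<odot> uncons (target g) = RPi_bang_ar f \<odot> uncons (target f) \<odot> (g \<boxtimes> RPi_bang_ar g)"
    using assms by (simp add: comp_assoc bang_uncons)
  also have "\<dots> = uncons (source f) \<odot> (f \<boxtimes> RPi_bang_ar f) \<odot> (g \<boxtimes> RPi_bang_ar g)"
    by (simp only: bang_uncons)
  also have "\<dots> = uncons (source f) \<odot> ((f \<odot> g) \<boxtimes> ?N)"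
    using assms by (simp add: comp_assoc tensor_comp)
  finally show "?N \<odot> uncons (target (f \<odot> g)) = uncons (source f) \<odot> ((f \<odot> g) \<boxtimes> ?N)"
    by simp
qed (simp_all add: RPi_bang_ar_def RPi_comp_def)

text \<open>At a one-element bag \<open>[y]\<close>, the column of \<open>!f\<close> is the column of \<open>f\<close> at \<open>y\<close>, placed on
  one-element bags.\<close>

lemma counit_natural:
  "RPi_bang_ar f \<odot> RPi_counit (target f) = RPi_counit (source f) \<odot> f"
proof (rule arrow_eqI)
  let ?X = "source f" and ?Y = "target f"
  show "RPi_bang_ar f \<odot> RPi_counit ?Y \<in> RPi_hom (RPi_bang_ob ?X) ?Y"
    "RPi_counit ?X \<odot> f \<in> RPi_hom (RPi_bang_ob ?X) ?Y"
    by (simp_all add: RPi_comp_def)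
  have "entry (RPi_bang_ar f \<odot> RPi_counit ?Y) (Bag M) y = entry (RPi_counit ?X \<odot> f) (Bag M) y"
    if M: "set_mset M \<subseteq> ?X" and y: "y \<in> ?Y" for M y
  proof -
    let ?r = "\<lambda>x. \<delta> (Bag M) (Bag {#x#}) * entry f x y"
    have "entry (RPi_bang_ar f \<odot> RPi_counit ?Y) (Bag M) y = power_column (entry f) {#y#} M"
      unfolding counit_cograph using M y by (subst comp_cograph) (simp_all add: entry_bang)
    also have "\<dots> = (\<Sum>x\<in>set_mset M. ?r x)"
      by (auto simp: power_column_add_mset \<delta>_def intro!: sum.cong dest!: multi_member_split)
    also have "\<dots> = csum ?r (set_mset M)"
      by (simp add: csum_finite)
    also have "\<dots> = csum ?r ?X"
      using M by (intro csum_mono_neutral[symmetric]) (auto simp: \<delta>_def)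
    also have "\<dots> = entry (RPi_counit ?X \<odot> f) (Bag M) y"
      using M y by (auto simp: entry_comp RPi_counit_def intro!: csum_cong)
    finally show ?thesis .
  qed
  then show "\<forall>p\<in>RPi_bang_ob ?X. \<forall>y\<in>?Y. entry (RPi_bang_ar f \<odot> RPi_counit ?Y) p y =
      entry (RPi_counit ?X \<odot> f) p y"
    by simp
qed

text \<open>Taking an element out of the first part of \<open>p = q + r\<close> amounts to taking it out of \<open>p\<close> and then
  splitting the rest (\<open>copy_uncons\<close>). So with \<open>M\<close> denoting either side, the recursion is
  \<open>uncons \<cdot> (f \<otimes> M)\<close>.\<close>

lemma copy_natural:
  assumes "f \<in> RPi_hom X Y"
  shows "RPi_bang_ar f \<odot> RPi_copy Y = RPi_copy X \<odot> (RPi_bang_ar f \<boxtimes> RPi_bang_ar f)"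
    (is "?M = ?N")
proof -
  have [simp]: "source f = X" "target f = Y"
    using assms by (simp_all add: source_hom target_hom)
  have idl: "RPi_ident (RPi_bang_ob X) \<odot> RPi_bang_ar f = RPi_bang_ar f"
    and idr: "RPi_bang_ar f \<odot> RPi_ident (RPi_bang_ob Y) = RPi_bang_ar f"
    and idf: "f \<odot> RPi_ident Y = f"
    using ident_comp[OF bang_in_hom[OF assms]] comp_ident[OF bang_in_hom[OF assms]]
      comp_ident[OF assms] by simp_all
  have copy_discard: "RPi_copy X \<odot> ((RPi_discard X \<boxtimes> RPi_ident (RPi_bang_ob X)) \<odot>
      RPi_lunit (RPi_bang_ob X)) = (RPi_ident (RPi_bang_ob X) :: ('a, 'r) arrow)" for X
    by (simp add: structure_cograph cograph_tensor cograph_comp_cograph; (rule cograph_eqI)?; simp)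
  have copy_uncons: "RPi_copy X \<odot> ((uncons X \<boxtimes> RPi_ident (RPi_bang_ob X)) \<odot>
      RPi_assoc X (RPi_bang_ob X) (RPi_bang_ob X)) =
      uncons X \<odot> (RPi_ident X \<boxtimes> RPi_copy X :: ('a, 'r) arrow)" for X
    by (simp add: uncons_def structure_cograph cograph_tensor cograph_comp_cograph)
  have discard_ident: "RPi_discard X \<odot> RPi_ident RPi_unit = (RPi_discard X :: ('a, 'r) arrow)"
    by (simp add: structure_cograph cograph_comp_cograph)
  let ?d = "\<lambda>X. RPi_discard X \<boxtimes> RPi_ident (RPi_bang_ob X) :: ('a, 'r) arrow"
  let ?u = "\<lambda>X. uncons X \<boxtimes> RPi_ident (RPi_bang_ob X) :: ('a, 'r) arrow"
  let ?l = "\<lambda>X. RPi_lunit (RPi_bang_ob X) :: ('a, 'r) arrow"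
  let ?a = "\<lambda>X. RPi_assoc X (RPi_bang_ob X) (RPi_bang_ob X) :: ('a, 'r) arrow"
  let ?F = "RPi_bang_ar f"
  show ?thesis
  proof (rule arrow_to_bang_tensor_eqI[of _ "RPi_bang_ob X" f "RPi_bang_ob Y" _ "uncons X"])
    have "?M \<odot> (?d Y \<odot> ?l Y) = ?F"
      by (simp add: comp_assoc copy_discard idr)
    also have "?F = (RPi_copy X \<odot> (?d X \<odot> ?l X)) \<odot> ?F"
      by (simp add: copy_discard idl)
    also have "\<dots> = RPi_copy X \<odot> (?d X \<odot> (RPi_ident RPi_unit \<boxtimes> ?F)) \<odot> ?l Y"
      using lunit_natural[of ?F] by (simp add: comp_assoc)
    also have "?d X \<odot> (RPi_ident RPi_unit \<boxtimes> ?F) = (?F \<boxtimes> ?F) \<odot> ?d Y"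
      using bang_discard[of f] by (simp add: idl idr discard_ident flip: tensor_comp)
    finally show "?M \<odot> ((RPi_discard (target f) \<boxtimes> RPi_ident (RPi_bang_ob Y)) \<odot> ?l Y) =
        ?N \<odot> ((RPi_discard (target f) \<boxtimes> RPi_ident (RPi_bang_ob Y)) \<odot> ?l Y)"
      by (simp add: comp_assoc)
    have "?M \<odot> (?u Y \<odot> ?a Y) = ?F \<odot> uncons Y \<odot> (RPi_ident Y \<boxtimes> RPi_copy Y)"
      by (simp add: comp_assoc copy_uncons)
    also have "\<dots> = uncons X \<odot> ((f \<boxtimes> ?F) \<odot> (RPi_ident Y \<boxtimes> RPi_copy Y))"
      using bang_uncons[of f] by (simp add: comp_assoc)
    also have "\<dots> = uncons X \<odot> (f \<boxtimes> ?M)"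
      by (simp add: idf flip: tensor_comp)
    finally show "?M \<odot> ((uncons (target f) \<boxtimes> RPi_ident (RPi_bang_ob Y)) \<odot>
        RPi_assoc (target f) (RPi_bang_ob (target f)) (RPi_bang_ob Y)) = uncons X \<odot> (f \<boxtimes> ?M)"
      by simp
    have "?N \<odot> (?u Y \<odot> ?a Y) = RPi_copy X \<odot> ((?F \<boxtimes> ?F) \<odot> ?u Y) \<odot> ?a Y"
      by (simp add: comp_assoc)
    also have "(?F \<boxtimes> ?F) \<odot> ?u Y = ?u X \<odot> ((f \<boxtimes> ?F) \<boxtimes> ?F)"
      using bang_uncons[of f] by (simp add: idl idr flip: tensor_comp)
    also have "RPi_copy X \<odot> (?u X \<odot> ((f \<boxtimes> ?F) \<boxtimes> ?F)) \<odot> ?a Y =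
        (RPi_copy X \<odot> (?u X \<odot> ?a X)) \<odot> (f \<boxtimes> (?F \<boxtimes> ?F))"
      using assoc_natural[of f ?F ?F] by (simp add: comp_assoc)
    also have "\<dots> = uncons X \<odot> ((RPi_ident X \<boxtimes> RPi_copy X) \<odot> (f \<boxtimes> (?F \<boxtimes> ?F)))"
      by (simp add: comp_assoc copy_uncons)
    also have "\<dots> = uncons X \<odot> (f \<boxtimes> ?N)"
      using ident_comp[OF assms] by (simp flip: tensor_comp)
    finally show "?N \<odot> ((uncons (target f) \<boxtimes> RPi_ident (RPi_bang_ob Y)) \<odot>
        RPi_assoc (target f) (RPi_bang_ob (target f)) (RPi_bang_ob Y)) = uncons X \<odot> (f \<boxtimes> ?N)"
      by simp
  qed (auto simp: RPi_comp_def RPi_bang_ar_def)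
qed

end

lemma set_mset_sum_bags_subset [simp]:
  "set_mset P \<subseteq> RPi_bang_ob X \<Longrightarrow> (\<Union>q\<in>set_mset P. set_mset (bag q)) \<subseteq> X"
  by (fastforce simp: RPi_bang_ob_def)

lemma image_subset_via [simp]: "A \<subseteq> X \<Longrightarrow> \<forall>x\<in>X. h x \<in> Y \<Longrightarrow> h ` A \<subseteq> Y"
  by blast

lemma pfst_image_subset [simp]: "A \<subseteq> RPi_tensor_ob X Y \<Longrightarrow> pfst ` A \<subseteq> X"
  and psnd_image_subset [simp]: "A \<subseteq> RPi_tensor_ob X Y \<Longrightarrow> psnd ` A \<subseteq> Y"
  by (auto simp: RPi_tensor_ob_def)

lemma image_mset_sum_bags:
  "image_mset h (\<Sum>p\<in>#P. bag p) = (\<Sum>p\<in>#P. image_mset h (bag p))"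
  by (induction P) simp_all

lemma sum_bags_sum_bags:
  "(\<Sum>p\<in>#(\<Sum>P\<in>#\<P>. bag P). bag p) = (\<Sum>P\<in>#\<P>. \<Sum>p\<in>#bag P. bag p)"
  by (induction \<P>) simp_all

lemma sum_singletons: "(\<Sum>x\<in>#M. {#x#}) = M"
  by (induction M) simp_all

text \<open>The symmetry of the two middle factors of a fourfold tensor product, which agrees with the
  interchange defined through associators (\<open>interchange_eq\<close> below).\<close>

definition swap_middle ::
  "'a elem set \<Rightarrow> 'a elem set \<Rightarrow> 'a elem set \<Rightarrow> 'a elem set \<Rightarrow> ('a, 'r::{zero, one}) arrow" where
  "swap_middle X Y Z W =
     graph_mat (RPi_tensor_ob (RPi_tensor_ob X Y) (RPi_tensor_ob Z W))
       (RPi_tensor_ob (RPi_tensor_ob X Z) (RPi_tensor_ob Y W))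
       (\<lambda>u. Pair (Pair (pfst (pfst u)) (pfst (psnd u))) (Pair (psnd (pfst u)) (psnd (psnd u))))"

lemma swap_middle_cograph: "swap_middle X Y Z W =
     cograph (RPi_tensor_ob (RPi_tensor_ob X Y) (RPi_tensor_ob Z W))
       (RPi_tensor_ob (RPi_tensor_ob X Z) (RPi_tensor_ob Y W))
       (\<lambda>u. Pair (Pair (pfst (pfst u)) (pfst (psnd u))) (Pair (psnd (pfst u)) (psnd (psnd u))))"
  unfolding swap_middle_def by (rule graph_eq_cograph) simp_all

lemma source_swap_middle [simp]:
    "source (swap_middle X Y Z W) = RPi_tensor_ob (RPi_tensor_ob X Y) (RPi_tensor_ob Z W)"
  and target_swap_middle [simp]:
    "target (swap_middle X Y Z W) = RPi_tensor_ob (RPi_tensor_ob X Z) (RPi_tensor_ob Y W)"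
  by (simp_all add: swap_middle_def graph_mat_def)

context elem_complete_semiring
begin

lemma swap_middle_natural:
  "((f \<boxtimes> g) \<boxtimes> (h \<boxtimes> k)) \<odot> swap_middle (target f) (target g) (target h) (target k) =
    swap_middle (source f) (source g) (source h) (source k) \<odot> ((f \<boxtimes> h) \<boxtimes> (g \<boxtimes> k))"
proof -
  have "((f \<boxtimes> g) \<boxtimes> (h \<boxtimes> k)) \<odot> swap_middle (target f) (target g) (target h) (target k) =
     mat (RPi_tensor_ob (RPi_tensor_ob (source f) (source g)) (RPi_tensor_ob (source h) (source k)))
       (RPi_tensor_ob (RPi_tensor_ob (target f) (target h)) (RPi_tensor_ob (target g) (target k)))
       (\<lambda>u v. entry ((f \<boxtimes> g) \<boxtimes> (h \<boxtimes> k)) u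
         (Pair (Pair (pfst (pfst v)) (pfst (psnd v))) (Pair (psnd (pfst v)) (psnd (psnd v)))))"
    unfolding swap_middle_cograph by (subst comp_cograph) simp_all
  also have "\<dots> = swap_middle (source f) (source g) (source h) (source k) \<odot> ((f \<boxtimes> h) \<boxtimes> (g \<boxtimes> k))"
    unfolding swap_middle_def
    by (subst graph_comp; (rule mat_eqI)?) (simp_all add: entry_tensor ac_simps)
  finally show ?thesis .
qed

interpretation smc: symmetric_monoidal_category UNIV RPi_hom RPi_ident "RPi_comp csum"
    RPi_tensor_ob RPi_tensor_ar RPi_unit RPi_assoc RPi_lunit RPi_runit RPi_sym
  by (rule symmetric_monoidal_category)

lemma interchange_eq: "smc.interchange X Y Z W = swap_middle X Y Z W"
  unfolding smc.interchange_def inv_assoc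
  by (simp add: swap_middle_cograph structure_cograph cograph_tensor cograph_comp_cograph)

text \<open>The sum of the bag of bags \<open>q + Q\<close> is \<open>q\<close> plus the sum of \<open>Q\<close> (\<open>comult_uncons\<close>), so with
  \<open>M\<close> denoting either side, the recursion is \<open>\<Delta> \<cdot> (!f \<otimes> M)\<close>.\<close>

lemma comult_natural:
  assumes "f \<in> RPi_hom X Y"
  shows "RPi_bang_ar f \<odot> RPi_comult Y = RPi_comult X \<odot> RPi_bang_ar (RPi_bang_ar f)"
    (is "?M = ?N")
proof -
  have [simp]: "source f = X" "target f = Y"
    using assms by (simp_all add: source_hom target_hom)
  let ?F = "RPi_bang_ar f"
  have idl: "RPi_ident (RPi_bang_ob X) \<odot> ?F = ?F"
    and idr: "?F \<odot> RPi_ident (RPi_bang_ob Y) = ?F"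
    using ident_comp[OF bang_in_hom[OF assms]] comp_ident[OF bang_in_hom[OF assms]] by simp_all
  have comult_discard: "RPi_comult X \<odot> RPi_discard (RPi_bang_ob X) =
      (RPi_discard X :: ('a, 'r) arrow)" for X
    by (simp add: structure_cograph cograph_comp_cograph)
  have comult_uncons: "RPi_comult X \<odot> uncons (RPi_bang_ob X) =
      RPi_copy X \<odot> (RPi_ident (RPi_bang_ob X) \<boxtimes> RPi_comult X :: ('a, 'r) arrow)" for X
    by (simp add: uncons_def structure_cograph cograph_tensor cograph_comp_cograph)
  show ?thesis
  proof (rule arrow_to_bang_eqI_tensor[of _ "RPi_bang_ob X" ?F _ "RPi_copy X"])
    show "?M \<odot> RPi_discard (target ?F) = ?N \<odot> RPi_discard (target ?F)"
      using bang_discard[of f] bang_discard[of ?F] by (simp add: comp_assoc comult_discard)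
    have "?M \<odot> uncons (target ?F) = ?F \<odot> RPi_copy Y \<odot> (RPi_ident (RPi_bang_ob Y) \<boxtimes> RPi_comult Y)"
      by (simp add: comp_assoc comult_uncons)
    also have "\<dots> = RPi_copy X \<odot> (?F \<boxtimes> ?M)"
      by (simp add: copy_natural[OF assms] comp_assoc idr flip: tensor_comp)
    finally show "?M \<odot> uncons (target ?F) = RPi_copy X \<odot> (?F \<boxtimes> ?M)" .
    have "?N \<odot> uncons (target ?F) = RPi_comult X \<odot> uncons (source ?F) \<odot> (?F \<boxtimes> RPi_bang_ar ?F)"
      using bang_uncons[of ?F] by (simp add: comp_assoc)
    also have "\<dots> = RPi_copy X \<odot> (?F \<boxtimes> ?N)"
      by (simp add: comult_uncons comp_assoc idl flip: tensor_comp)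
    finally show "?N \<odot> uncons (target ?F) = RPi_copy X \<odot> (?F \<boxtimes> ?N)" .
  qed (simp_all add: RPi_comp_def RPi_bang_ar_def)
qed

text \<open>Projecting after the insertion of a pair is the same as inserting its components into the two
  projections (\<open>mon_uncons\<close>). So with \<open>M\<close> denoting either side, the recursion takes one element out of
  each of the two bags, pairs them, and continues with \<open>M\<close>.\<close>

lemma mon_natural:
  assumes "f \<in> RPi_hom X X'" "g \<in> RPi_hom Y Y'"
  shows "(RPi_bang_ar f \<boxtimes> RPi_bang_ar g) \<odot> RPi_mon X' Y' = RPi_mon X Y \<odot> RPi_bang_ar (f \<boxtimes> g)"
    (is "?M = ?N")
proof -
  have [simp]: "source f = X" "target f = X'" "source g = Y" "target g = Y'"
    using assms by (simp_all add: source_hom target_hom)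
  let ?F = "RPi_bang_ar f" and ?G = "RPi_bang_ar g"
  let ?B = "\<lambda>X Y. (uncons X \<boxtimes> uncons Y) \<odot> swap_middle X (RPi_bang_ob X) Y (RPi_bang_ob Y)
    :: ('a, 'r) arrow"
  have mon_discard: "RPi_mon X Y \<odot> RPi_discard (RPi_tensor_ob X Y) =
      (RPi_discard X \<boxtimes> RPi_discard Y :: ('a, 'r) arrow) \<odot> RPi_lunit RPi_unit" for X Y
    by (simp add: structure_cograph cograph_tensor cograph_comp_cograph)
  have mon_uncons: "RPi_mon X Y \<odot> uncons (RPi_tensor_ob X Y) =
      ?B X Y \<odot> (RPi_ident (RPi_tensor_ob X Y) \<boxtimes> RPi_mon X Y)" for X Y
    by (simp add: uncons_def swap_middle_cograph structure_cograph cograph_tensor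
        cograph_comp_cograph; (rule cograph_eqI)?; simp)
  have fg: "f \<boxtimes> g \<in> RPi_hom (RPi_tensor_ob X Y) (RPi_tensor_ob X' Y')"
    using assms by (rule tensor_in_hom)
  show ?thesis
  proof (rule arrow_to_bang_eqI_tensor[of _
        "RPi_tensor_ob (RPi_bang_ob X) (RPi_bang_ob Y)" "f \<boxtimes> g" _ "?B X Y"])
    have "?M \<odot> RPi_discard (target (f \<boxtimes> g)) =
        ((?F \<boxtimes> ?G) \<odot> (RPi_discard X' \<boxtimes> RPi_discard Y')) \<odot> RPi_lunit RPi_unit"
      by (simp add: comp_assoc mon_discard)
    also have "\<dots> = RPi_mon X Y \<odot> RPi_discard (RPi_tensor_ob X Y)"
      using bang_discard[of f] bang_discard[of g] by (simp add: mon_discard flip: tensor_comp)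
    also have "\<dots> = ?N \<odot> RPi_discard (target (f \<boxtimes> g))"
      using bang_discard[of "f \<boxtimes> g"] by (simp add: comp_assoc)
    finally show "?M \<odot> RPi_discard (target (f \<boxtimes> g)) = ?N \<odot> RPi_discard (target (f \<boxtimes> g))" .
    have "?M \<odot> uncons (target (f \<boxtimes> g)) = ((?F \<boxtimes> ?G) \<odot> (uncons X' \<boxtimes> uncons Y')) \<odot>
        swap_middle X' (RPi_bang_ob X') Y' (RPi_bang_ob Y') \<odot>
        (RPi_ident (RPi_tensor_ob X' Y') \<boxtimes> RPi_mon X' Y')"
      by (simp add: comp_assoc mon_uncons)
    also have "(?F \<boxtimes> ?G) \<odot> (uncons X' \<boxtimes> uncons Y') =
        (uncons X \<boxtimes> uncons Y) \<odot> ((f \<boxtimes> ?F) \<boxtimes> (g \<boxtimes> ?G))"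
      using bang_uncons[of f] bang_uncons[of g] by (simp flip: tensor_comp)
    also have "(uncons X \<boxtimes> uncons Y) \<odot> ((f \<boxtimes> ?F) \<boxtimes> (g \<boxtimes> ?G)) \<odot>
        swap_middle X' (RPi_bang_ob X') Y' (RPi_bang_ob Y') \<odot>
        (RPi_ident (RPi_tensor_ob X' Y') \<boxtimes> RPi_mon X' Y') =
        ?B X Y \<odot> (((f \<boxtimes> g) \<boxtimes> (?F \<boxtimes> ?G)) \<odot> (RPi_ident (RPi_tensor_ob X' Y') \<boxtimes> RPi_mon X' Y'))"
      using swap_middle_natural[of f ?F g ?G] by (simp add: comp_assoc)
    also have "\<dots> = ?B X Y \<odot> ((f \<boxtimes> g) \<boxtimes> ?M)"
      by (simp add: comp_ident[OF fg] flip: tensor_comp)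
    finally show "?M \<odot> uncons (target (f \<boxtimes> g)) = ?B X Y \<odot> ((f \<boxtimes> g) \<boxtimes> ?M)" .
    have "?N \<odot> uncons (target (f \<boxtimes> g)) =
        (RPi_mon X Y \<odot> uncons (RPi_tensor_ob X Y)) \<odot> ((f \<boxtimes> g) \<boxtimes> RPi_bang_ar (f \<boxtimes> g))"
      using bang_uncons[of "f \<boxtimes> g"] by (simp add: comp_assoc)
    also have "\<dots> = ?B X Y \<odot> ((RPi_ident (RPi_tensor_ob X Y) \<boxtimes> RPi_mon X Y) \<odot>
        ((f \<boxtimes> g) \<boxtimes> RPi_bang_ar (f \<boxtimes> g)))"
      by (simp add: comp_assoc mon_uncons)
    also have "\<dots> = ?B X Y \<odot> ((f \<boxtimes> g) \<boxtimes> ?N)"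
      by (simp add: ident_comp[OF fg] flip: tensor_comp)
    finally show "?N \<odot> uncons (target (f \<boxtimes> g)) = ?B X Y \<odot> ((f \<boxtimes> g) \<boxtimes> ?N)" .
  qed (simp_all add: RPi_comp_def RPi_bang_ar_def RPi_tensor_ar_def)
qed

lemma coalgebra_modality:
  "coalgebra_modality UNIV RPi_hom RPi_ident (RPi_comp csum)
    RPi_tensor_ob RPi_tensor_ar RPi_unit RPi_assoc RPi_lunit RPi_runit RPi_sym
    RPi_bang_ob RPi_bang_ar RPi_comult RPi_counit RPi_copy RPi_discard"
proof (intro coalgebra_modality.intro symmetric_monoidal_category coalgebra_modality_axioms.intro)
  fix f g :: "('a, 'r) arrow" and A B C :: "'a elem set"
  show "RPi_bang_ar f \<in> RPi_hom (RPi_bang_ob A) (RPi_bang_ob B)" if "f \<in> RPi_hom A B"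
    using that by (rule bang_in_hom)
  show "RPi_bang_ar (f \<odot> g) = RPi_bang_ar f \<odot> RPi_bang_ar g"
    if "f \<in> RPi_hom A B" "g \<in> RPi_hom B C"
    using that by (intro bang_comp) (simp add: source_hom target_hom)
  show "RPi_bang_ar f \<odot> RPi_comult B = RPi_comult A \<odot> RPi_bang_ar (RPi_bang_ar f)"
    if "f \<in> RPi_hom A B" using that by (rule comult_natural)
  show "RPi_bang_ar f \<odot> RPi_counit B = RPi_counit A \<odot> f" if "f \<in> RPi_hom A B"
    using that counit_natural[of f] by (simp add: source_hom target_hom)
  show "RPi_bang_ar f \<odot> RPi_copy B = RPi_copy A \<odot> (RPi_bang_ar f \<boxtimes> RPi_bang_ar f)"
    if "f \<in> RPi_hom A B" using that by (rule copy_natural)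
  show "RPi_bang_ar f \<odot> RPi_discard B = RPi_discard A" if "f \<in> RPi_hom A B"
    using that bang_discard[of f] by (simp add: source_hom target_hom)
  (* The comonad and comonoid laws are identities for sums of bags. *)
qed (simp_all add: structure_cograph cograph_tensor cograph_comp_cograph bang_cograph,
  (rule cograph_eqI;
    simp add: multiset.map_comp o_def sum_bags_sum_bags sum_singletons ac_simps)+)

lemma monoidal_coalgebra_modality:
  "monoidal_coalgebra_modality UNIV RPi_hom RPi_ident (RPi_comp csum)
    RPi_tensor_ob RPi_tensor_ar RPi_unit RPi_assoc RPi_lunit RPi_runit RPi_sym
    RPi_bang_ob RPi_bang_ar RPi_comult RPi_counit RPi_copy RPi_discard RPi_mon RPi_mon_unit"
proof (intro monoidal_coalgebra_modality.intro coalgebra_modality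
    monoidal_coalgebra_modality_axioms.intro)
  fix f g :: "('a, 'r) arrow" and A A' B B' C :: "'a elem set"
  show "(RPi_bang_ar f \<boxtimes> RPi_bang_ar g) \<odot> RPi_mon A' B' = RPi_mon A B \<odot> RPi_bang_ar (f \<boxtimes> g)"
    if "f \<in> RPi_hom A A'" "g \<in> RPi_hom B B'"
    using that by (rule mon_natural)
  show "RPi_mon_unit \<odot> RPi_copy RPi_unit =
      smc.inv_ar (RPi_lunit RPi_unit) \<odot> (RPi_mon_unit \<boxtimes> RPi_mon_unit)"
    unfolding inv_lunit
    by (simp add: structure_cograph cograph_tensor cograph_comp_cograph)
qed (simp_all add: interchange_eq swap_middle_cograph structure_cograph cograph_tensor
      cograph_comp_cograph bang_cograph,
  (rule cograph_eqI; simp add: multiset.map_comp o_def image_mset_sum_bags sum_bags_sum_bags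
      sum_mset.distrib)+)

end

section \<open>The deriving transformation\<close>

lemma nat_sum_0 [simp]: "nat_sum 0 = (0 :: 'r::{comm_monoid_add, one})"
  and nat_sum_Suc: "nat_sum (Suc n) = nat_sum n + (1 :: 'r::{comm_monoid_add, one})"
  by (simp_all add: nat_sum_def add.commute)

lemma nat_sum_add: "nat_sum (m + n) = nat_sum m + (nat_sum n :: 'r::{comm_monoid_add, one})"
  by (induction n) (simp_all add: nat_sum_Suc ac_simps)

lemma nat_sum_mult: "nat_sum (m * n) = nat_sum m * (nat_sum n :: 'r::{semiring_0, monoid_mult})"
  by (induction n) (simp_all add: nat_sum_Suc nat_sum_add distrib_left ac_simps)

lemma nat_sum_sum: "nat_sum (\<Sum>i\<in>A. f i) = (\<Sum>i\<in>A. nat_sum (f i) :: 'r::{comm_monoid_add, one})"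
  by (induction A rule: infinite_finite_induct) (simp_all add: nat_sum_add)

text \<open>The matrix \<open>!f\<close> is homogeneous: each factor \<open>pick f y\<close> raises the degree by one.\<close>

lemma power_column_eq_0: "size p \<noteq> size q \<Longrightarrow> power_column f q p = 0"
proof (induction q arbitrary: p)
  case (add y q)
  have "power_column f q (p - {#x#}) = 0" if "x \<in># p" for x
    using that add.prems by (intro add.IH) (auto dest!: multi_member_split)
  then show ?case by (simp add: power_column_add_mset)
qed (auto simp: \<delta>_def)

lemma power_column_zero:
  "power_column (\<lambda>x y. 0) q p = \<delta> q {#} * (\<delta> p {#} :: 'r::{comm_semiring_0, comm_monoid_mult})"
  by (cases q) (simp_all add: power_column_add_mset)

lemma count_sum_bags:
  "count (\<Sum>t\<in>#P. bag t) x = (\<Sum>t\<in>set_mset P. count P t * count (bag t) x)"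
proof (induction P)
  case (add t P)
  have "(\<Sum>s\<in>set_mset (add_mset t P). count (add_mset t P) s * count (bag s) x) =
      (\<Sum>s\<in>insert t (set_mset P). (if s = t then count (bag s) x else 0) + count P s * count (bag s) x)"
    by (intro sum.cong) (auto simp: algebra_simps)
  also have "\<dots> = count (bag t) x + (\<Sum>s\<in>insert t (set_mset P). count P s * count (bag s) x)"
    by (simp add: sum.distrib)
  also have "(\<Sum>s\<in>insert t (set_mset P). count P s * count (bag s) x) =
      (\<Sum>s\<in>set_mset P. count P s * count (bag s) x)"
    by (cases "t \<in># P") (simp_all add: insert_absorb not_in_iff)
  finally show ?case using add by simp
qed simp

lemma entry_deriv:
  assumes "set_mset p \<subseteq> X" "x \<in> X" "set_mset q \<subseteq> X"
  shows "entry (RPi_deriv X) (Pair (Bag p) x) (Bag q) = nat_sum (count q x) * \<delta> (add_mset x p) q"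
  using assms by (simp add: RPi_deriv_def \<delta>_def)

lemma deriv_in_hom: "RPi_deriv X \<in> RPi_hom (RPi_tensor_ob (RPi_bang_ob X) X) (RPi_bang_ob X)"
  by (simp add: RPi_deriv_def)

text \<open>Where the entry is nonzero, \<open>q\<close> is \<open>p + x\<close>, so the multiplicity can be read off from the row index.\<close>

lemma deriv_weighted_graph:
  "RPi_deriv X = (mat (RPi_tensor_ob (RPi_bang_ob X) X) (RPi_bang_ob X)
     (\<lambda>u q. nat_sum (Suc (count (bag (pfst u)) (psnd u))) *
       \<delta> (Bag (add_mset (psnd u) (bag (pfst u)))) q) :: ('a, 'r::{semiring_0, monoid_mult}) arrow)"
  unfolding RPi_deriv_def by (rule mat_eqI) (auto simp: \<delta>_def)

text \<open>If \<open>x\<close> does not occur in \<open>q\<close>, the coefficient is zero; this makes up for the truncation in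
  \<open>q - {#x#}\<close>.\<close>

lemma count_mult_delta:
  "nat_sum (count q x) * \<delta> p (r + (q - {#x#})) =
   (nat_sum (count q x) * \<delta> (add_mset x p) (r + q) :: 'r::{semiring_0, monoid_mult})"
proof (cases "x \<in># q")
  case True
  then obtain q' where "q = add_mset x q'" by (blast dest: multi_member_split)
  then show ?thesis by (simp add: \<delta>_def)
next
  case False
  then show ?thesis by (simp add: not_in_iff)
qed

context elem_complete_semiring
begin

interpretation smc: symmetric_monoidal_category UNIV RPi_hom RPi_ident "RPi_comp csum"
    RPi_tensor_ob RPi_tensor_ar RPi_unit RPi_assoc RPi_lunit RPi_runit RPi_sym
  by (rule symmetric_monoidal_category)

text \<open>The common shape of the composites in the rules below: some data \<open>a\<close> and a bag \<open>s\<close> are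
  merged into \<open>k a s\<close>, the element \<open>x\<close> is kept apart, and then \<open>x\<close> is inserted into \<open>s\<close>. In the
  column at \<open>(a, q)\<close>, the row at \<open>(p, x)\<close> leaves only \<open>s = q - x\<close>.\<close>

lemma entry_cograph_deriv:
  assumes "p \<in> V" "x \<in> X" "a \<in> A" "set_mset q \<subseteq> X"
  shows "entry (cograph (RPi_tensor_ob V X) (RPi_tensor_ob A (RPi_tensor_ob (RPi_bang_ob X) X))
      (\<lambda>u. Pair (k (pfst u) (bag (pfst (psnd u)))) (psnd (psnd u))) \<odot> (RPi_ident A \<boxtimes> RPi_deriv X))
      (Pair p x) (Pair a (Bag q)) =
    nat_sum (count q x) * \<delta> p (k a (q - {#x#}))"
    (is "entry (?C \<odot> ?D) ?v ?z = _")
proof -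
  let ?U = "RPi_tensor_ob A (RPi_tensor_ob (RPi_bang_ob X) X)"
  let ?u = "Pair a (Pair (Bag (q - {#x#})) x)"
  have sub: "set_mset (q - {#x#}) \<subseteq> X"
    using assms by (auto dest: in_diffD)
  have "entry (?C \<odot> ?D) ?v ?z = csum (\<lambda>u. entry ?C ?v u * entry ?D u ?z) ?U"
    using assms by (simp add: entry_comp)
  also have "\<dots> = entry ?C ?v ?u * entry ?D ?u ?z"
  proof (rule csum_eq_single)
    show "?u \<in> ?U" using assms sub by simp
    fix u assume "u \<in> ?U" "u \<noteq> ?u"
    then obtain b s y where u: "u = Pair b (Pair (Bag s) y)" "b \<in> A" "set_mset s \<subseteq> X" "y \<in> X"
      by (auto simp: RPi_tensor_ob_def RPi_bang_ob_def)
    then have "b \<noteq> a \<or> y \<noteq> x \<or> add_mset x s \<noteq> q" using \<open>u \<noteq> ?u\<close> by auto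
    then show "entry ?C ?v u * entry ?D u ?z = 0"
      using u assms by (auto simp: entry_tensor entry_deriv RPi_ident_def cograph_def \<delta>_def)
  qed
  also have "\<dots> = nat_sum (count q x) * \<delta> p (k a (q - {#x#}))"
    using assms sub
    by (cases "x \<in># q")
      (simp_all add: entry_tensor entry_deriv RPi_ident_def cograph_def not_in_iff, simp add: \<delta>_def)
  finally show ?thesis .
qed

text \<open>When an element is taken out of a bag into which \<open>x\<close> has just been inserted, it is either \<open>x\<close>
  itself or one of the old elements. This corresponds to
  \<open>count (y + q) x = \<delta> x y + count q x\<close>.\<close>

lemma deriv_uncons:
  "RPi_deriv X \<odot> uncons X = RPi_plus (RPi_sym (RPi_bang_ob X) X)
    ((uncons X \<boxtimes> RPi_ident X) \<odot> RPi_assoc X (RPi_bang_ob X) X \<odot> (RPi_ident X \<boxtimes> RPi_deriv X))"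
    (is "?L = RPi_plus ?S (?B \<odot> ?D)")
proof (rule arrow_eqI)
  let ?V = "RPi_tensor_ob (RPi_bang_ob X) X" and ?U = "RPi_tensor_ob X (RPi_bang_ob X)"
  show "?L \<in> RPi_hom ?V ?U" "RPi_plus ?S (?B \<odot> ?D) \<in> RPi_hom ?V ?U"
    by (simp_all add: RPi_comp_def RPi_plus_def)
  have B: "?B = cograph ?V (RPi_tensor_ob X ?V)
      (\<lambda>u. Pair ((\<lambda>y s. Bag (add_mset y s)) (pfst u) (bag (pfst (psnd u)))) (psnd (psnd u)))"
    by (simp add: uncons_def structure_cograph cograph_tensor cograph_comp_cograph)
  have entry_B: "entry (?B \<odot> ?D) (Pair (Bag p) x) (Pair y (Bag q)) =
      nat_sum (count q x) * \<delta> (Bag p) (Bag (add_mset y (q - {#x#})))"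
    if "set_mset p \<subseteq> X" "x \<in> X" "y \<in> X" "set_mset q \<subseteq> X" for p q x y
    unfolding B using that by (subst entry_cograph_deriv) simp_all
  have "entry ?L (Pair (Bag p) x) (Pair y (Bag q)) =
      entry (RPi_plus ?S (?B \<odot> ?D)) (Pair (Bag p) x) (Pair y (Bag q))"
    if "set_mset p \<subseteq> X" "x \<in> X" "y \<in> X" "set_mset q \<subseteq> X" for p q x y
  proof -
    have "entry ?L (Pair (Bag p) x) (Pair y (Bag q)) =
        nat_sum (count (add_mset y q) x) * \<delta> (add_mset x p) (add_mset y q)"
      unfolding uncons_def using that by (subst comp_cograph) (simp_all add: entry_deriv)
    also have "\<dots> = \<delta> x y * \<delta> p q + nat_sum (count q x) * \<delta> (add_mset x p) (add_mset y q)"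
      by (auto simp: nat_sum_Suc \<delta>_def distrib_right add.commute)
    also have "\<dots> = \<delta> x y * \<delta> p q + nat_sum (count q x) * \<delta> (Bag p) (Bag (add_mset y (q - {#x#})))"
      using count_mult_delta[of q x p "{#y#}", where 'r = 'r] by (simp add: \<delta>_def)
    also have "\<dots> = entry (RPi_plus ?S (?B \<odot> ?D)) (Pair (Bag p) x) (Pair y (Bag q))"
      using that by (simp add: RPi_plus_def entry_B RPi_sym_def graph_mat_def) (simp add: \<delta>_def)
    finally show ?thesis .
  qed
  then show "\<forall>u\<in>?V. \<forall>v\<in>?U. entry ?L u v = entry (RPi_plus ?S (?B \<odot> ?D)) u v"
    by simp
qed

lemma deriv_discard:
  "RPi_deriv X \<odot> RPi_discard X = RPi_zero (RPi_tensor_ob (RPi_bang_ob X) X) RPi_unit"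
  unfolding discard_cograph
  by (subst comp_cograph; (unfold RPi_zero_def)?; (rule mat_eqI)?) (simp_all add: entry_deriv)

text \<open>By \<open>deriv_uncons\<close>, both sides satisfy \<open>M \<cdot> uncons = \<sigma> \<cdot> (f \<otimes> !f) + B \<cdot> (f \<otimes> M)\<close>, where \<open>B\<close>
  takes an old element out of the bag.\<close>

lemma deriv_natural:
  assumes "f \<in> RPi_hom X Y"
  shows "(RPi_bang_ar f \<boxtimes> f) \<odot> RPi_deriv Y = RPi_deriv X \<odot> RPi_bang_ar f" (is "?M = ?N")
proof -
  have [simp]: "source f = X" "target f = Y"
    using assms by (simp_all add: source_hom target_hom)
  let ?F = "RPi_bang_ar f"
  let ?B = "\<lambda>X. (uncons X \<boxtimes> RPi_ident X) \<odot> RPi_assoc X (RPi_bang_ob X) X :: ('a, 'r) arrow"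
  let ?S = "RPi_sym (RPi_bang_ob X) X \<odot> (f \<boxtimes> ?F)"
  have B: "(?F \<boxtimes> f) \<odot> ?B Y = ?B X \<odot> (f \<boxtimes> (?F \<boxtimes> f))"
  proof -
    have "(?F \<boxtimes> f) \<odot> ?B Y = ((?F \<odot> uncons Y) \<boxtimes> (f \<odot> RPi_ident Y)) \<odot> RPi_assoc Y (RPi_bang_ob Y) Y"
      by (simp add: tensor_comp comp_assoc)
    also have "\<dots> = ((uncons X \<odot> (f \<boxtimes> ?F)) \<boxtimes> (RPi_ident X \<odot> f)) \<odot> RPi_assoc Y (RPi_bang_ob Y) Y"
      using bang_uncons[of f] ident_comp[OF assms] comp_ident[OF assms] by simp
    also have "\<dots> = ?B X \<odot> (f \<boxtimes> (?F \<boxtimes> f))"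
      using assoc_natural[of f ?F f] by (simp add: tensor_comp comp_assoc)
    finally show ?thesis .
  qed
  show ?thesis
  proof (rule arrow_to_bang_eqI_plus[of _ "RPi_tensor_ob (RPi_bang_ob X) X" f _ "?B X" ?S])
    have "?M \<odot> RPi_discard Y = (?F \<boxtimes> f) \<odot> RPi_zero (RPi_tensor_ob (RPi_bang_ob Y) Y) RPi_unit"
      by (simp add: comp_assoc deriv_discard)
    also have "\<dots> = RPi_zero (RPi_tensor_ob (RPi_bang_ob X) X) RPi_unit"
      unfolding RPi_comp_def RPi_zero_def by (rule mat_eqI) (auto intro!: csum_eq_zero)
    also have "\<dots> = ?N \<odot> RPi_discard Y"
      using bang_discard[of f] by (simp add: comp_assoc deriv_discard)
    finally show "?M \<odot> RPi_discard (target f) = ?N \<odot> RPi_discard (target f)" by simp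
    have "?M \<odot> uncons Y = RPi_plus ((?F \<boxtimes> f) \<odot> RPi_sym (RPi_bang_ob Y) Y)
        ((?F \<boxtimes> f) \<odot> ?B Y \<odot> (RPi_ident Y \<boxtimes> RPi_deriv Y))"
      by (simp add: comp_assoc deriv_uncons comp_plus)
    also have "(?F \<boxtimes> f) \<odot> RPi_sym (RPi_bang_ob Y) Y = ?S"
      using sym_natural[of ?F f] by simp
    also have "(?F \<boxtimes> f) \<odot> ?B Y \<odot> (RPi_ident Y \<boxtimes> RPi_deriv Y) =
        ?B X \<odot> ((f \<boxtimes> (?F \<boxtimes> f)) \<odot> (RPi_ident Y \<boxtimes> RPi_deriv Y))"
      by (simp only: B) (simp add: comp_assoc)
    also have "\<dots> = ?B X \<odot> (f \<boxtimes> ?M)"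
      by (simp add: comp_ident[OF assms] flip: tensor_comp)
    finally show "?M \<odot> uncons (target f) = RPi_plus ?S (?B X \<odot> (f \<boxtimes> ?M))" by simp
    have "?N \<odot> uncons Y = RPi_deriv X \<odot> uncons X \<odot> (f \<boxtimes> ?F)"
      using bang_uncons[of f] by (simp add: comp_assoc)
    also have "\<dots> = RPi_plus ?S (?B X \<odot> ((RPi_ident X \<boxtimes> RPi_deriv X) \<odot> (f \<boxtimes> ?F)))"
      by (simp add: deriv_uncons plus_comp comp_assoc)
    also have "\<dots> = RPi_plus ?S (?B X \<odot> (f \<boxtimes> ?N))"
      by (simp add: ident_comp[OF assms] flip: tensor_comp)
    finally show "?N \<odot> uncons (target f) = RPi_plus ?S (?B X \<odot> (f \<boxtimes> ?N))" by simp
  qed (simp_all add: RPi_comp_def RPi_bang_ar_def)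
qed

lemma deriv_linear:
  "RPi_deriv X \<odot> RPi_counit X = (RPi_discard X \<boxtimes> RPi_ident X) \<odot> RPi_lunit X"
proof -
  have "RPi_deriv X \<odot> RPi_counit X =
      cograph (RPi_tensor_ob (RPi_bang_ob X) X) X (Pair (Bag {#}))"
    unfolding counit_cograph
    by (subst comp_cograph; (unfold cograph_def)?; (rule mat_eqI)?)
      (auto simp: entry_deriv \<delta>_def nat_sum_Suc)
  then show ?thesis
    by (simp add: structure_cograph cograph_tensor cograph_comp_cograph)
qed

text \<open>At row \<open>(p, x)\<close> and column \<open>(q, r)\<close> all terms are supported on \<open>p + x = q + r\<close>, where they read
  \<open>count (q + r) x = count q x + count r x\<close>. The first summand on the right is the second
  one followed by the symmetry.\<close>

lemma deriv_Leibniz: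
  defines "L \<equiv> \<lambda>X. (RPi_copy X \<boxtimes> RPi_ident X) \<odot> RPi_assoc (RPi_bang_ob X) (RPi_bang_ob X) X"
  shows "RPi_deriv X \<odot> RPi_copy X = RPi_plus
    (L X \<odot> (RPi_ident (RPi_bang_ob X) \<boxtimes> RPi_sym (RPi_bang_ob X) X)
       \<odot> smc.inv_ar (RPi_assoc (RPi_bang_ob X) X (RPi_bang_ob X))
       \<odot> (RPi_deriv X \<boxtimes> RPi_ident (RPi_bang_ob X)))
    (L X \<odot> (RPi_ident (RPi_bang_ob X) \<boxtimes> RPi_deriv X))"
    (is "?L = RPi_plus (?B1 \<odot> ?D1) (?B2 \<odot> ?D2)")
proof (rule arrow_eqI)
  let ?Z = "RPi_bang_ob X"
  let ?V = "RPi_tensor_ob ?Z X" and ?U = "RPi_tensor_ob ?Z ?Z"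
  let ?C = "cograph ?V (RPi_tensor_ob ?Z ?V)
    (\<lambda>u. Pair ((\<lambda>r s. Bag (bag r + s)) (pfst u) (bag (pfst (psnd u)))) (psnd (psnd u))) :: ('a, 'r) arrow"
  show "?L \<in> RPi_hom ?V ?U" "RPi_plus (?B1 \<odot> ?D1) (?B2 \<odot> ?D2) \<in> RPi_hom ?V ?U"
    by (simp_all add: RPi_comp_def RPi_plus_def L_def)
  have B2: "?B2 = ?C"
    by (simp add: L_def structure_cograph cograph_tensor cograph_comp_cograph)
  have B1: "?B1 = ?C \<odot> RPi_sym ?Z ?V"
    unfolding L_def inv_assoc
    by (simp add: structure_cograph cograph_tensor cograph_comp_cograph; (rule cograph_eqI)?;
        simp add: add.commute)
  have entry_C: "entry (?C \<odot> ?D2) (Pair (Bag p) x) (Pair (Bag r) (Bag q)) =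
      nat_sum (count q x) * \<delta> (add_mset x p) (r + q)"
    if "set_mset p \<subseteq> X" "x \<in> X" "set_mset r \<subseteq> X" "set_mset q \<subseteq> X" for p q r x
    using that count_mult_delta[of q x p r, where 'r = 'r]
    by (subst entry_cograph_deriv) (simp_all add: \<delta>_def)
  have entry_B2: "entry (?B2 \<odot> ?D2) (Pair (Bag p) x) (Pair (Bag r) (Bag q)) =
      nat_sum (count q x) * \<delta> (add_mset x p) (r + q)"
    if "set_mset p \<subseteq> X" "x \<in> X" "set_mset r \<subseteq> X" "set_mset q \<subseteq> X" for p q r x
    unfolding B2 using that by (rule entry_C)
  have "?B1 \<odot> ?D1 = ?C \<odot> ?D2 \<odot> RPi_sym ?Z ?Z"
    using sym_natural[of "RPi_ident ?Z" "RPi_deriv X"] by (simp add: B1 comp_assoc)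
  then have entry_B1: "entry (?B1 \<odot> ?D1) (Pair (Bag p) x) (Pair (Bag q) (Bag r)) =
      nat_sum (count q x) * \<delta> (add_mset x p) (q + r)"
    if "set_mset p \<subseteq> X" "x \<in> X" "set_mset r \<subseteq> X" "set_mset q \<subseteq> X" for p q r x
    unfolding sym_cograph using that entry_C[of p x r q]
    by (simp add: comp_cograph add.commute)
  have "entry ?L (Pair (Bag p) x) (Pair (Bag q) (Bag r)) =
      entry (RPi_plus (?B1 \<odot> ?D1) (?B2 \<odot> ?D2)) (Pair (Bag p) x) (Pair (Bag q) (Bag r))"
    if "set_mset p \<subseteq> X" "x \<in> X" "set_mset r \<subseteq> X" "set_mset q \<subseteq> X" for p q r x
  proof -
    have "entry ?L (Pair (Bag p) x) (Pair (Bag q) (Bag r)) =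
        nat_sum (count (q + r) x) * \<delta> (add_mset x p) (q + r)"
      unfolding copy_cograph using that by (subst comp_cograph) (simp_all add: entry_deriv)
    also have "\<dots> = entry (?B1 \<odot> ?D1) (Pair (Bag p) x) (Pair (Bag q) (Bag r)) +
        entry (?B2 \<odot> ?D2) (Pair (Bag p) x) (Pair (Bag q) (Bag r))"
      using that by (simp only: entry_B1 entry_B2 count_union nat_sum_add distrib_right)
    also have "\<dots> = entry (RPi_plus (?B1 \<odot> ?D1) (?B2 \<odot> ?D2)) (Pair (Bag p) x) (Pair (Bag q) (Bag r))"
      using that by (simp add: RPi_plus_def L_def)
    finally show ?thesis .
  qed
  then show "\<forall>u\<in>?V. \<forall>v\<in>?U. entry ?L u v = entry (RPi_plus (?B1 \<odot> ?D1) (?B2 \<odot> ?D2)) u v"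
    by simp
qed

text \<open>The column of \<open>\<d>\<close> at \<open>q\<close> has finite support: a row index in it is a choice of an element \<open>x\<close> of \<open>q\<close>
  to be the inserted one.\<close>

lemma entry_comp_deriv:
  assumes "v \<in> source B" "target B = RPi_tensor_ob (RPi_bang_ob X) X" "set_mset q \<subseteq> X"
  shows "entry (B \<odot> RPi_deriv X) v (Bag q) =
    (\<Sum>x\<in>set_mset q. nat_sum (count q x) * entry B v (Pair (Bag (q - {#x#})) x))"
proof -
  let ?h = "\<lambda>x. Pair (Bag (q - {#x#})) x"
  let ?r = "\<lambda>u. entry B v u * entry (RPi_deriv X) u (Bag q)"
  have sub: "set_mset (q - {#x#}) \<subseteq> X" for x
    using assms(3) by (auto dest: in_diffD)
  have "entry (B \<odot> RPi_deriv X) v (Bag q) = csum ?r (target B)"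
    using assms by (simp add: entry_comp)
  also have "\<dots> = csum ?r (?h ` set_mset q)"
  proof (rule csum_mono_neutral)
    show "?h ` set_mset q \<subseteq> target B" using assms sub by auto
    fix u assume *: "u \<in> target B" "u \<notin> ?h ` set_mset q"
    then obtain s x where u: "u = Pair (Bag s) x" "set_mset s \<subseteq> X" "x \<in> X"
      using assms(2) by (auto simp: RPi_tensor_ob_def RPi_bang_ob_def)
    then have "add_mset x s \<noteq> q" using * by auto
    then show "?r u = 0" using u assms(3) by (simp add: entry_deriv)
  qed
  also have "\<dots> = (\<Sum>x\<in>set_mset q. ?r (?h x))"
    by (subst csum_finite) (simp_all add: sum.reindex inj_on_def)
  also have "\<dots> = (\<Sum>x\<in>set_mset q. nat_sum (count q x) * entry B v (?h x))"
  proof (intro sum.cong refl)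
    fix x assume x: "x \<in># q"
    then have "x \<in> X" using assms(3) by auto
    then show "?r (?h x) = nat_sum (count q x) * entry B v (?h x)"
      using x sub assms(3) by (simp add: entry_deriv mult.commute)
  qed
  finally show ?thesis .
qed

text \<open>At row \<open>(p, x)\<close> and column \<open>P\<close> both sides are supported on \<open>p + x = \<Sum>P\<close>. On the right, one chooses a
  bag \<open>t\<close> in \<open>P\<close> and an occurrence of \<open>x\<close> in \<open>t\<close>; altogether these are the occurrences of
  \<open>x\<close> in \<open>\<Sum>P\<close> (\<open>count_sum_bags\<close>).\<close>

lemma deriv_chain:
  "RPi_deriv X \<odot> RPi_comult X = (RPi_copy X \<boxtimes> RPi_ident X) \<odot>
    RPi_assoc (RPi_bang_ob X) (RPi_bang_ob X) X \<odot> (RPi_comult X \<boxtimes> RPi_deriv X) \<odot>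
    RPi_deriv (RPi_bang_ob X)"
    (is "?L = ?B \<odot> ?D")
proof (rule arrow_eqI)
  let ?Z = "RPi_bang_ob X"
  let ?V = "RPi_tensor_ob ?Z X" and ?U = "RPi_bang_ob ?Z"
  let ?C = "cograph ?V (RPi_tensor_ob ?U ?V)
    (\<lambda>u. Pair ((\<lambda>R s. Bag ((\<Sum>t\<in>#bag R. bag t) + s)) (pfst u) (bag (pfst (psnd u)))) (psnd (psnd u)))
    :: ('a, 'r) arrow"
  show "?L \<in> RPi_hom ?V ?U" "?B \<odot> ?D \<in> RPi_hom ?V ?U"
    by (simp_all add: RPi_comp_def)
  have "?B = (RPi_copy X \<boxtimes> RPi_ident X) \<odot> RPi_assoc ?Z ?Z X \<odot>
      (RPi_comult X \<boxtimes> RPi_ident ?V) \<odot> (RPi_ident ?U \<boxtimes> RPi_deriv X)"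
    using ident_comp[OF deriv_in_hom, of X] comp_ident[of "RPi_comult X" ?Z ?U]
    by (simp add: comp_assoc RPi_comult_def flip: tensor_comp)
  also have "(RPi_copy X \<boxtimes> RPi_ident X) \<odot> RPi_assoc ?Z ?Z X \<odot> (RPi_comult X \<boxtimes> RPi_ident ?V) = ?C"
    by (simp add: structure_cograph cograph_tensor cograph_comp_cograph; (rule cograph_eqI)?; simp)
  finally have B: "?B = ?C \<odot> (RPi_ident ?U \<boxtimes> RPi_deriv X)" .
  have entry_B: "entry ?B (Pair (Bag p) x) (Pair (Bag R) (Bag t)) =
      nat_sum (count t x) * \<delta> (add_mset x p) ((\<Sum>t\<in>#R. bag t) + t)"
    if "set_mset p \<subseteq> X" "x \<in> X" "set_mset R \<subseteq> ?Z" "set_mset t \<subseteq> X" for p x R t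
    unfolding B using that count_mult_delta[of t x p "\<Sum>t\<in>#R. bag t", where 'r = 'r]
    by (subst entry_cograph_deriv) (simp_all add: \<delta>_def)
  have "entry ?L (Pair (Bag p) x) (Bag P) = entry (?B \<odot> ?D) (Pair (Bag p) x) (Bag P)"
    if p: "set_mset p \<subseteq> X" and x: "x \<in> X" and P: "set_mset P \<subseteq> ?Z" for p x P
  proof -
    let ?\<delta> = "\<delta> (add_mset x p) (\<Sum>t\<in>#P. bag t) :: 'r"
    have "entry (?B \<odot> ?D) (Pair (Bag p) x) (Bag P) = (\<Sum>t\<in>set_mset P. nat_sum (count P t) *
        entry ?B (Pair (Bag p) x) (Pair (Bag (P - {#t#})) t))"
      using p x P by (intro entry_comp_deriv) simp_all
    also have "\<dots> = (\<Sum>t\<in>set_mset P. nat_sum (count P t * count (bag t) x) * ?\<delta>)"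
    proof (intro sum.cong refl)
      fix t assume t: "t \<in># P"
      then obtain P' where P': "P = add_mset t P'" by (blast dest: multi_member_split)
      then obtain s where s: "t = Bag s" "set_mset s \<subseteq> X" "set_mset P' \<subseteq> ?Z"
        using P by (auto simp: RPi_bang_ob_def)
      then have "entry ?B (Pair (Bag p) x) (Pair (Bag (P - {#t#})) t) =
          nat_sum (count (bag t) x) * ?\<delta>"
        using p x P' by (simp add: entry_B add.commute)
      then show "nat_sum (count P t) * entry ?B (Pair (Bag p) x) (Pair (Bag (P - {#t#})) t) =
          nat_sum (count P t * count (bag t) x) * ?\<delta>"
        by (simp only: nat_sum_mult mult.assoc)
    qed
    also have "\<dots> = nat_sum (count (\<Sum>t\<in>#P. bag t) x) * ?\<delta>"
      by (simp add: count_sum_bags nat_sum_sum sum_distrib_right)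
    also have "\<dots> = entry ?L (Pair (Bag p) x) (Bag P)"
      unfolding comult_cograph using p x P by (subst comp_cograph) (simp_all add: entry_deriv)
    finally show ?thesis ..
  qed
  then show "\<forall>u\<in>?V. \<forall>P\<in>?U. entry ?L u P = entry (?B \<odot> ?D) u P"
    by simp
qed

text \<open>Inserting \<open>x\<close> and then \<open>y\<close> into \<open>p\<close> gives the coefficient \<open>count (p + x) x * count (p + x + y) y\<close>.
  If \<open>x \<noteq> y\<close>, this is \<open>(count p x + 1) * (count p y + 1)\<close>, hence symmetric.\<close>

lemma deriv_interchange:
  "(RPi_deriv X \<boxtimes> RPi_ident X) \<odot> RPi_deriv X =
    RPi_assoc (RPi_bang_ob X) X X \<odot> (RPi_ident (RPi_bang_ob X) \<boxtimes> RPi_sym X X) \<odot>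
      smc.inv_ar (RPi_assoc (RPi_bang_ob X) X X) \<odot> (RPi_deriv X \<boxtimes> RPi_ident X) \<odot> RPi_deriv X"
proof -
  let ?V = "RPi_tensor_ob (RPi_bang_ob X) X"
  let ?W = "RPi_tensor_ob ?V X"
  let ?D = "(RPi_deriv X \<boxtimes> RPi_ident X) \<odot> RPi_deriv X"
  let ?swap = "\<lambda>u. Pair (Pair (pfst (pfst u)) (psnd u)) (psnd (pfst u))"
  let ?h = "\<lambda>u. Bag (add_mset (psnd u) (bag (pfst u)))"
  let ?w = "\<lambda>u. nat_sum (Suc (count (bag (pfst u)) (psnd u)))"
  have "RPi_deriv X \<boxtimes> RPi_ident X =
      mat ?W ?V (\<lambda>u v. ?w (pfst u) * \<delta> (Pair (?h (pfst u)) (psnd u)) v)"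
    unfolding RPi_tensor_ar_def
    by (rule mat_eqI) (simp_all add: deriv_weighted_graph RPi_ident_def mult.assoc, simp add: \<delta>_def)
  then have D: "?D = mat ?W (RPi_bang_ob X)
      (\<lambda>u q. ?w (pfst u) * entry (RPi_deriv X) (Pair (?h (pfst u)) (psnd u)) q)"
    by (simp add: weighted_graph_comp)
  have "RPi_assoc (RPi_bang_ob X) X X \<odot> (RPi_ident (RPi_bang_ob X) \<boxtimes> RPi_sym X X) \<odot>
      smc.inv_ar (RPi_assoc (RPi_bang_ob X) X X) = cograph ?W ?W ?swap"
    unfolding inv_assoc by (simp add: structure_cograph cograph_tensor cograph_comp_cograph)
  also have "\<dots> = graph_mat ?W ?W ?swap"
    by (rule graph_eq_cograph[symmetric]) simp_all
  finally have swap: "RPi_assoc (RPi_bang_ob X) X X \<odot> (RPi_ident (RPi_bang_ob X) \<boxtimes> RPi_sym X X) \<odot>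
      smc.inv_ar (RPi_assoc (RPi_bang_ob X) X X) = graph_mat ?W ?W ?swap" .
  have "graph_mat ?W ?W ?swap \<odot> ?D = mat ?W (RPi_bang_ob X) (\<lambda>u q. entry ?D (?swap u) q)"
    by (subst graph_comp) simp_all
  also have "\<dots> = ?D"
    unfolding D by (rule mat_eqI) (auto simp: entry_deriv ac_simps \<delta>_def)
  finally show ?thesis
    unfolding swap by (simp add: comp_assoc graph_mat_def)
qed

lemma differential_category:
  "differential_category UNIV RPi_hom RPi_ident (RPi_comp csum)
    RPi_tensor_ob RPi_tensor_ar RPi_unit RPi_assoc RPi_lunit RPi_runit RPi_sym RPi_plus RPi_zero
    RPi_bang_ob RPi_bang_ar RPi_comult RPi_counit RPi_copy RPi_discard RPi_deriv"
  by (intro differential_category.intro additive_symmetric_monoidal_category coalgebra_modality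
      differential_category_axioms.intro deriv_in_hom deriv_natural deriv_discard deriv_Leibniz
      deriv_linear deriv_chain deriv_interchange)

section \<open>Antiderivatives\<close>

lemma diagonal_comp:
  assumes "source g = X"
  shows "mat X X (\<lambda>x y. w x * \<delta> x y) \<odot> g = mat X (target g) (\<lambda>x z. w x * entry g x z)"
  using assms by (subst weighted_graph_comp) simp_all

lemma comp_diagonal:
  assumes "target f = X"
  shows "f \<odot> mat X X (\<lambda>x y. w x * \<delta> x y) = mat (source f) X (\<lambda>x z. entry f x z * w z)"
  unfolding RPi_comp_def source_mat target_mat
proof (intro mat_eqI ballI refl)
  fix x z assume "x \<in> source f" "z \<in> X"
  then show "csum (\<lambda>y. entry f x y * entry (mat X X (\<lambda>x y. w x * \<delta> x y)) y z) (target f) =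
      entry f x z * w z"
    using assms by (subst csum_eq_single[of z]) simp_all
qed

end

text \<open>The diagonal entries of \<open>K\<close>. At the empty bag, \<open>\<d>\<degree> \<cdot> \<d>\<close> vanishes and the value 1 comes from
  \<open>!(0)\<close>.\<close>

definition K_weight :: "'a elem \<Rightarrow> 'r::{comm_monoid_add, one}" where
  "K_weight q = (if q = Bag {#} then 1 else nat_sum (size (bag q)))"

context elem_complete_semiring
begin

interpretation dc: differential_category UNIV RPi_hom RPi_ident "RPi_comp csum"
    RPi_tensor_ob RPi_tensor_ar RPi_unit RPi_assoc RPi_lunit RPi_runit RPi_sym RPi_plus RPi_zero
    RPi_bang_ob RPi_bang_ar RPi_comult RPi_counit RPi_copy RPi_discard RPi_deriv
  by (rule differential_category)

lemma K_diagonal: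
  "dc.K X = mat (RPi_bang_ob X) (RPi_bang_ob X) (\<lambda>p q. K_weight p * \<delta> p q)"
proof -
  let ?Z = "RPi_bang_ob X"
  have coderiv: "dc.coderiv X =
      cograph ?Z (RPi_tensor_ob ?Z X) (\<lambda>u. Bag (add_mset (psnd u) (bag (pfst u))))"
    unfolding dc.coderiv_def by (simp add: structure_cograph cograph_tensor cograph_comp_cograph)
  have "entry (dc.coderiv X \<odot> RPi_deriv X) (Bag p) (Bag q) +
      entry (RPi_bang_ar (RPi_zero X X)) (Bag p) (Bag q) = K_weight (Bag p) * \<delta> (Bag p) (Bag q)"
    if p: "set_mset p \<subseteq> X" and q: "set_mset q \<subseteq> X" for p q
  proof -
    have "entry (dc.coderiv X \<odot> RPi_deriv X) (Bag p) (Bag q) = (\<Sum>x\<in>set_mset q. nat_sum (count q x) *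
        entry (dc.coderiv X) (Bag p) (Pair (Bag (q - {#x#})) x))"
      using p q by (intro entry_comp_deriv) (simp_all add: coderiv)
    also have "\<dots> = (\<Sum>x\<in>set_mset q. nat_sum (count q x) * \<delta> p q)"
    proof (intro sum.cong refl)
      fix x assume "x \<in># q"
      then obtain q' where "q = add_mset x q'" by (blast dest: multi_member_split)
      then show "nat_sum (count q x) * entry (dc.coderiv X) (Bag p) (Pair (Bag (q - {#x#})) x) =
          nat_sum (count q x) * \<delta> p q"
        using p q by (simp add: coderiv cograph_def \<delta>_def)
    qed
    also have "\<dots> = nat_sum (size q) * \<delta> p q"
      by (simp add: size_multiset_overloaded_eq nat_sum_sum sum_distrib_right)
    finally have "entry (dc.coderiv X \<odot> RPi_deriv X) (Bag p) (Bag q) = nat_sum (size q) * \<delta> p q" .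
    moreover have "entry (RPi_bang_ar (RPi_zero X X)) (Bag p) (Bag q) = \<delta> q {#} * (\<delta> p {#} :: 'r)"
    proof -
      have "entry (RPi_zero X X :: ('a, 'r) arrow) = (\<lambda>x y. 0)"
        by (simp add: RPi_zero_def entry_mat fun_eq_iff)
      then show ?thesis
        using p q by (subst entry_bang) (simp_all add: power_column_zero, simp_all add: RPi_zero_def)
    qed
    ultimately show ?thesis
      by (auto simp: K_weight_def \<delta>_def)
  qed
  then show ?thesis
    unfolding dc.K_def RPi_plus_def
    by (intro mat_eqI) (simp_all add: coderiv RPi_zero_def)
qed

text \<open>Positive multiples of 1 are invertible, which gives the inverse of \<open>K\<close>. For naturality it suffices to
  compare bags of equal size, by homogeneity of \<open>!f\<close>, and on these the weights agree.\<close>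

lemma has_antiderivatives:
  assumes "\<And>n::nat. n \<ge> 1 \<Longrightarrow> \<exists>r::'r. nat_sum n * r = 1"
  shows dc.has_antiderivatives
  unfolding dc.has_antiderivatives_def K_diagonal
proof (intro conjI ballI allI)
  fix X :: "'a elem set"
  let ?Z = "RPi_bang_ob X"
  have "\<forall>q\<in>?Z. \<exists>r. K_weight q * r = (1 :: 'r)"
    using assms by (auto simp: K_weight_def Suc_le_eq nonempty_has_size)
  from bchoice[OF this] obtain v where v: "\<forall>q\<in>?Z. K_weight q * v q = (1 :: 'r)"
    by blast
  let ?K = "mat ?Z ?Z (\<lambda>p q. K_weight p * \<delta> p q)" and ?L = "mat ?Z ?Z (\<lambda>p q. v p * \<delta> p q)"
  have "?K \<odot> ?L = mat ?Z ?Z (\<lambda>p q. (K_weight p * v p) * \<delta> p q)"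
    "?L \<odot> ?K = mat ?Z ?Z (\<lambda>p q. (K_weight p * v p) * \<delta> p q)"
    by (subst diagonal_comp; (rule mat_eqI)?; simp add: ac_simps)+
  moreover have "mat ?Z ?Z (\<lambda>p q. (K_weight p * v p) * \<delta> p q) = RPi_ident ?Z"
    unfolding RPi_ident_def by (rule mat_eqI) (use v in simp_all)
  ultimately have "dc.inverse_arrows ?Z ?Z ?K ?L"
    by (simp add: dc.inverse_arrows_def)
  then show "dc.iso ?Z ?Z (mat ?Z ?Z (\<lambda>p q. K_weight p * \<delta> p q :: 'r))"
    unfolding dc.iso_def by blast
next
  fix X Y :: "'a elem set" and f :: "('a, 'r) arrow"
  assume f: "f \<in> RPi_hom X Y"
  have weight: "entry (RPi_bang_ar f) (Bag p) (Bag q) * K_weight (Bag q) =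
      K_weight (Bag p) * entry (RPi_bang_ar f) (Bag p) (Bag q)"
    if "set_mset p \<subseteq> X" "set_mset q \<subseteq> Y" for p q
  proof (cases "size p = size q")
    case True
    then have "K_weight (Bag p) = (K_weight (Bag q) :: 'r)"
      by (auto simp: K_weight_def)
    then show ?thesis by (simp add: mult.commute)
  next
    case False
    then show ?thesis
      using that f by (simp add: entry_bang source_hom target_hom power_column_eq_0)
  qed
  have "RPi_bang_ar f \<odot> mat (RPi_bang_ob Y) (RPi_bang_ob Y) (\<lambda>p q. K_weight p * \<delta> p q) =
      mat (RPi_bang_ob X) (RPi_bang_ob Y) (\<lambda>p q. entry (RPi_bang_ar f) p q * K_weight q)"
    using f by (simp add: comp_diagonal source_hom target_hom)
  also have "\<dots> = mat (RPi_bang_ob X) (RPi_bang_ob Y) (\<lambda>p q. K_weight p * entry (RPi_bang_ar f) p q)"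
    by (rule mat_eqI) (simp_all add: weight)
  also have "\<dots> = mat (RPi_bang_ob X) (RPi_bang_ob X) (\<lambda>p q. K_weight p * \<delta> p q) \<odot> RPi_bang_ar f"
    using f by (simp add: diagonal_comp source_hom target_hom)
  finally show "RPi_bang_ar f \<odot> mat (RPi_bang_ob Y) (RPi_bang_ob Y) (\<lambda>p q. K_weight p * \<delta> p q) =
      mat (RPi_bang_ob X) (RPi_bang_ob X) (\<lambda>p q. K_weight p * \<delta> p q) \<odot> RPi_bang_ar f" .
qed

end

theorem theorem6p1:
  fixes csum :: "('a elem \<Rightarrow> 'r::{comm_semiring_0, comm_monoid_mult}) \<Rightarrow> 'a elem set \<Rightarrow> 'r"
  assumes "complete_semiring csum"
    and "\<And>n::nat. n \<ge> 1 \<Longrightarrow> \<exists>r::'r. nat_sum n * r = 1"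
  shows "differential_linear_category_with_antiderivatives
    UNIV RPi_hom RPi_ident (RPi_comp csum)
    RPi_tensor_ob RPi_tensor_ar RPi_unit RPi_assoc RPi_lunit RPi_runit RPi_sym
    RPi_plus RPi_zero
    RPi_bang_ob RPi_bang_ar RPi_comult RPi_counit RPi_copy RPi_discard
    RPi_deriv
    RPi_mon RPi_mon_unit"
proof -
  interpret elem_complete_semiring csum
    using assms(1) by (rule elem_complete_semiring.intro)
  show ?thesis
    by (intro differential_linear_category_with_antiderivatives.intro
        differential_linear_category.intro differential_category monoidal_coalgebra_modality
        differential_linear_category_with_antiderivatives_axioms.intro has_antiderivatives assms(2))
qed

end
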